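(* Let $m \ge 4$ and $n_1,n_2\ge 0$ be integers. Then the $3$-strand graph braid group $B_3(\mathcal P_{m,n_1,n_2})$ of the pulsar graph $\mathcal P_{m,n_1,n_2}$ is not a free group.
   Context: For a finite graph $\Gamma$ (viewed as a topological space, a finite 1-dimensional CW complex), the configuration space of $n$ unordered points is $\mathrm{Conf}_n(\Gamma) = (\Gamma^n - \Delta)/S_n$, where $\Delta = \{(x_1,\dots,x_n) : x_i = x_j \text{ for some } i\neq j\}$ and the symmetric group $S_n$ permutes the factors. The $n$-strand graph braid group is $B_n(\Gamma) = \pi_1(\mathrm{Conf}_n(\Gamma))$. The generalized theta graph $\Theta_m$ is the suspension of $m$ points: two vertices $a_1,a_2$ joined by $m$ arcs that are disjoint except at their endpoints. The pulsar graph $\mathcal P_{m,n_1,n_2}$ is obtained from $\Theta_m$ by attaching $n_1$ rays at $a_1$ and $n_2$ rays at $a_2$; here a ray is an edge with one endpoint glued to the graph and the other endpoint a new vertex of degree 1. *)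

theory Defs
  imports "HOL-Analysis.Analysis" "HOL-Algebra.Group" "Graph_Theory.Digraph"
begin

section \<open>Quotient topology\<close>

definition quotient_topology :: "'a topology \<Rightarrow> ('a \<Rightarrow> 'b) \<Rightarrow> 'b topology" where
  "quotient_topology X f =
     topology (\<lambda>U. U \<subseteq> f ` topspace X \<and> openin X {x \<in> topspace X. f x \<in> U})"

lemma openin_quotient_topology:
  "openin (quotient_topology X f) U \<longleftrightarrow>
     U \<subseteq> f ` topspace X \<and> openin X {x \<in> topspace X. f x \<in> U}"
proof -
  have "istopology (\<lambda>U. U \<subseteq> f ` topspace X \<and> openin X {x \<in> topspace X. f x \<in> U})"
    unfolding istopology_def
  proof (intro conjI allI impI)
    fix S T
    assume S: "S \<subseteq> f ` topspace X \<and> openin X {x \<in> topspace X. f x \<in> S}"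
      and T: "T \<subseteq> f ` topspace X \<and> openin X {x \<in> topspace X. f x \<in> T}"
    have "{x \<in> topspace X. f x \<in> S \<inter> T} =
            {x \<in> topspace X. f x \<in> S} \<inter> {x \<in> topspace X. f x \<in> T}" by auto
    with S T show "openin X {x \<in> topspace X. f x \<in> S \<inter> T}" by auto
    show "S \<inter> T \<subseteq> f ` topspace X" using S by auto
  next
    fix K
    assume K: "\<forall>S\<in>K. S \<subseteq> f ` topspace X \<and> openin X {x \<in> topspace X. f x \<in> S}"
    have "{x \<in> topspace X. f x \<in> \<Union>K} = (\<Union>S\<in>K. {x \<in> topspace X. f x \<in> S})" by auto
    with K show "openin X {x \<in> topspace X. f x \<in> \<Union>K}" by auto
    show "\<Union>K \<subseteq> f ` topspace X" using K by auto
  qed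
  then show ?thesis by (simp add: quotient_topology_def topology_inverse')
qed

lemma topspace_quotient_topology [simp]:
  "topspace (quotient_topology X f) = f ` topspace X"
proof -
  have "{x \<in> topspace X. f x \<in> f ` topspace X} = topspace X" by auto
  then have "openin (quotient_topology X f) (f ` topspace X)"
    by (simp add: openin_quotient_topology)
  then show ?thesis
    by (metis openin_quotient_topology openin_subset openin_topspace subset_antisym)
qed

lemma quotient_map_quotient_topology: "quotient_map X (quotient_topology X f) f"
  by (auto simp: quotient_map_def openin_quotient_topology)

section \<open>Graphs as topological spaces\<close>

text \<open>
  A graph with possibly parallel edges is given by a \<^typ>\<open>('v, 'e) pre_digraph\<close>.  The
  orientation of an edge only serves to parametrise it by \<open>[0,1]\<close>.  The realization is the
  quotient of the disjoint union of the (discrete) vertex set and one copy of \<open>[0,1]\<close> for each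
  edge in which the ends of the intervals are glued to the end vertices.  \<open>Inner e t\<close> with
  \<open>0 < t < 1\<close> represents the points of the open edge \<open>e\<close>.
\<close>

datatype ('v, 'e) graph_point = Vertex 'v | Inner 'e real

definition graph_pieces :: "('v, 'e) pre_digraph \<Rightarrow> (('v + 'e) \<times> real) topology" where
  "graph_pieces G =
     sum_topology (\<lambda>i. case i of Inl v \<Rightarrow> top_of_set {0} | Inr e \<Rightarrow> top_of_set {0..1})
       (verts G <+> arcs G)"

definition graph_glue :: "('v, 'e) pre_digraph \<Rightarrow> ('v + 'e) \<times> real \<Rightarrow> ('v, 'e) graph_point" where
  "graph_glue G = (\<lambda>(i, t). case i of
       Inl v \<Rightarrow> Vertex v
     | Inr e \<Rightarrow> if t = 0 then Vertex (tail G e)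
               else if t = 1 then Vertex (head G e)
               else Inner e t)"

definition graph_space :: "('v, 'e) pre_digraph \<Rightarrow> ('v, 'e) graph_point topology" where
  "graph_space G = quotient_topology (graph_pieces G) (graph_glue G)"

section \<open>Configuration spaces\<close>

definition ordered_conf :: "nat \<Rightarrow> 'a topology \<Rightarrow> (nat \<Rightarrow> 'a) topology" where
  "ordered_conf n X = subtopology (product_topology (\<lambda>_. X) {..<n}) {x. inj_on x {..<n}}"

text \<open>
  Points of the product are \<open>undefined\<close> outside \<open>{..<n}\<close>; composition with a permutation of
  \<open>{..<n}\<close>, which is the identity elsewhere, preserves this.
\<close>

definition perm_orbit :: "nat \<Rightarrow> (nat \<Rightarrow> 'a) \<Rightarrow> (nat \<Rightarrow> 'a) set" where
  "perm_orbit n x = {x \<circ> \<sigma> | \<sigma>. \<sigma> permutes {..<n}}"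

definition Conf :: "nat \<Rightarrow> 'a topology \<Rightarrow> (nat \<Rightarrow> 'a) set topology" where
  "Conf n X = quotient_topology (ordered_conf n X) (perm_orbit n)"

section \<open>The fundamental group of an abstract topological space\<close>

definition loops_at :: "'a topology \<Rightarrow> 'a \<Rightarrow> (real \<Rightarrow> 'a) set" where
  "loops_at X x = {p. pathin X p \<and> p 0 = x \<and> p 1 = x}"

definition loop_homotopy :: "'a topology \<Rightarrow> 'a \<Rightarrow> ((real \<Rightarrow> 'a) \<times> (real \<Rightarrow> 'a)) set" where
  "loop_homotopy X x =
     {(p, q). homotopic_with (\<lambda>r. r 0 = x \<and> r 1 = x) (top_of_set {0..1}) X p q}"

text \<open>
  This is \<^const>\<open>joinpaths\<close>, which is not available for points whose type has no
  canonical topology.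
\<close>

definition loop_join :: "(real \<Rightarrow> 'a) \<Rightarrow> (real \<Rightarrow> 'a) \<Rightarrow> real \<Rightarrow> 'a" where
  "loop_join p q = (\<lambda>t. if t \<le> 1/2 then p (2 * t) else q (2 * t - 1))"

definition fundamental_group :: "'a topology \<Rightarrow> 'a \<Rightarrow> (real \<Rightarrow> 'a) set monoid" where
  "fundamental_group X x =
     \<lparr>carrier = loops_at X x // loop_homotopy X x,
      mult = (\<lambda>A B. \<Union>p\<in>A. \<Union>q\<in>B. loop_homotopy X x `` {loop_join p q}),
      one = loop_homotopy X x `` {\<lambda>_. x}\<rparr>"

lemma equiv_loop_homotopy: "equiv (loops_at X x) (loop_homotopy X x)"
proof (rule equivI)
  show "loop_homotopy X x \<subseteq> loops_at X x \<times> loops_at X x"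
    by (auto simp: loop_homotopy_def loops_at_def pathin_def
        dest: homotopic_with_imp_continuous_maps homotopic_with_imp_property)
  show "refl_on (loops_at X x) (loop_homotopy X x)"
    by (auto simp: refl_on_def loop_homotopy_def loops_at_def pathin_def)
  show "sym (loop_homotopy X x)"
    by (auto simp: sym_def loop_homotopy_def intro: homotopic_with_symD)
  show "trans (loop_homotopy X x)"
    by (auto simp: trans_def loop_homotopy_def intro: homotopic_with_trans)
qed

lemma loop_homotopy_iff:
  fixes X :: "'a topology"
  shows "(p, q) \<in> loop_homotopy X x \<longleftrightarrow>
     (\<exists>h :: real \<times> real \<Rightarrow> 'a. continuous_map (top_of_set ({0..1} \<times> {0..1})) X h \<and>
          (\<forall>t\<in>{0..1}. h (0, t) = p t) \<and> (\<forall>t\<in>{0..1}. h (1, t) = q t) \<and>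
          (\<forall>s\<in>{0..1}. h (s, 0) = x \<and> h (s, 1) = x))"
proof -
  have "prod_topology (top_of_set {0..1::real}) (top_of_set {0..1::real}) =
          top_of_set ({0..1} \<times> {0..1})"
    by simp
  then show ?thesis
    unfolding loop_homotopy_def by (simp add: homotopic_with)
qed

lemma loop_homotopy_reparam:
  fixes p :: "real \<Rightarrow> 'a"
  assumes p: "pathin X p"
    and f: "continuous_on {0..1} f" "f ` {0..1} \<subseteq> {0..1}"
    and g: "continuous_on {0..1} g" "g ` {0..1} \<subseteq> {0..1}"
    and ends: "f 0 = g 0" "f 1 = g 1" "p (f 0) = x" "p (f 1) = x"
    and q: "\<And>t. t \<in> {0..1} \<Longrightarrow> q t = p (f t)" and r: "\<And>t. t \<in> {0..1} \<Longrightarrow> r t = p (g t)"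
  shows "(q, r) \<in> loop_homotopy X x"
proof -
  let ?k = "\<lambda>z::real \<times> real. (1 - fst z) * f (snd z) + fst z * g (snd z)"
  have "continuous_on ({0..1} \<times> {0..1}) ?k"
    by (intro continuous_intros continuous_on_compose2[OF f(1)] continuous_on_compose2[OF g(1)])
      auto
  moreover have "?k \<in> {0..1} \<times> {0..1} \<rightarrow> {0..1}"
  proof
    fix z :: "real \<times> real" assume z: "z \<in> {0..1} \<times> {0..1}"
    then have "f (snd z) \<in> {0..1}" "g (snd z) \<in> {0..1}" using f(2) g(2) by auto
    then have "(1 - fst z) *\<^sub>R f (snd z) + fst z *\<^sub>R g (snd z) \<in> {0..1}"
      by (intro convexD[OF convex_real_interval(5)]) (use z in auto)
    then show "?k z \<in> {0..1}" by simp
  qed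
  ultimately have "continuous_map (top_of_set ({0..1} \<times> {0..1})) (top_of_set {0..1}) ?k"
    by simp
  from continuous_map_compose[OF this p[unfolded pathin_def]]
  show ?thesis
    unfolding loop_homotopy_iff
    by (intro exI[of _ "p \<circ> ?k"]) (use ends in \<open>auto simp: q r algebra_simps\<close>)
qed

lemma loop_join_homotopy:
  assumes "(p, p') \<in> loop_homotopy X x" "(q, q') \<in> loop_homotopy X x"
  shows "(loop_join p q, loop_join p' q') \<in> loop_homotopy X x"
proof -
  let ?S = "{0..1::real} \<times> {0..1::real}"
  obtain h where h: "continuous_map (top_of_set ?S) X h"
    "\<forall>t\<in>{0..1}. h (0, t) = p t" "\<forall>t\<in>{0..1}. h (1, t) = p' t"
    "\<forall>s\<in>{0..1}. h (s, 0) = x \<and> h (s, 1) = x"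
    using assms(1) unfolding loop_homotopy_iff by blast
  obtain k where k: "continuous_map (top_of_set ?S) X k"
    "\<forall>t\<in>{0..1}. k (0, t) = q t" "\<forall>t\<in>{0..1}. k (1, t) = q' t"
    "\<forall>s\<in>{0..1}. k (s, 0) = x \<and> k (s, 1) = x"
    using assms(2) unfolding loop_homotopy_iff by blast
  define H where "H = (\<lambda>z. if snd z \<le> 1/2 then (h \<circ> (\<lambda>z. (fst z, 2 * snd z))) z
                              else (k \<circ> (\<lambda>z. (fst z, 2 * snd z - 1))) z)"
  have "continuous_map (top_of_set ?S) X H"
    unfolding H_def
  proof (rule continuous_map_cases_le)
    show "continuous_map (subtopology (top_of_set ?S) {z \<in> topspace (top_of_set ?S). snd z \<le> 1/2})
            X (h \<circ> (\<lambda>z. (fst z, 2 * snd z)))"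
      by (rule continuous_map_compose[OF _ h(1)])
        (auto simp: subtopology_subtopology intro!: continuous_intros)
    show "continuous_map (subtopology (top_of_set ?S) {z \<in> topspace (top_of_set ?S). 1/2 \<le> snd z})
            X (k \<circ> (\<lambda>z. (fst z, 2 * snd z - 1)))"
      by (rule continuous_map_compose[OF _ k(1)])
        (auto simp: subtopology_subtopology intro!: continuous_intros)
    show "(h \<circ> (\<lambda>z. (fst z, 2 * snd z))) z = (k \<circ> (\<lambda>z. (fst z, 2 * snd z - 1))) z"
      if "z \<in> topspace (top_of_set ?S)" "snd z = 1/2" for z
    proof -
      have "2 * snd z = 1" "2 * snd z - 1 = 0" using that by simp_all
      then show ?thesis
        using that h(4) k(4) by (simp only: o_apply topspace_euclidean_subtopology mem_Times_iff)
    qed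
  qed (auto intro!: continuous_intros)
  then show ?thesis
    unfolding loop_homotopy_iff
    by (intro exI[of _ H]) (use h k in \<open>auto simp: H_def loop_join_def\<close>)
qed

lemma loop_join_in_loops:
  assumes "p \<in> loops_at X x" "q \<in> loops_at X x"
  shows "loop_join p q \<in> loops_at X x"
proof -
  have "(p, p) \<in> loop_homotopy X x" "(q, q) \<in> loop_homotopy X x"
    using assms equiv_loop_homotopy[of X x] by (auto simp: equiv_def refl_on_def)
  from loop_join_homotopy[OF this] show ?thesis
    using equiv_loop_homotopy[of X x] by (auto simp: equiv_def)
qed

lemma fundamental_group_mult:
  assumes "p \<in> loops_at X x" "q \<in> loops_at X x"
  shows "(loop_homotopy X x `` {p}) \<otimes>\<^bsub>fundamental_group X x\<^esub> (loop_homotopy X x `` {q}) =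
           loop_homotopy X x `` {loop_join p q}"
proof -
  note E = equiv_loop_homotopy[of X x]
  have "congruent2 (loop_homotopy X x) (loop_homotopy X x)
          (\<lambda>p q. loop_homotopy X x `` {loop_join p q})"
    unfolding congruent2_def
    by (auto intro!: equiv_class_eq[OF E] loop_join_homotopy)
  from UN_equiv_class2[OF E E this assms] show ?thesis
    by (simp add: fundamental_group_def)
qed

lemma continuous_on_piecewise:
  fixes f g :: "real \<Rightarrow> real"
  assumes "continuous_on {0..a} f" "continuous_on {a..b} g" "f a = g a" "0 \<le> a" "a \<le> b"
  shows "continuous_on {0..b} (\<lambda>t. if t \<le> a then f t else g t)"
proof -
  have "{0..b} = {0..a} \<union> {a..b}" using assms by auto
  moreover have "continuous_on ({0..a} \<union> {a..b}) (\<lambda>t. if t \<le> a then f t else g t)"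
    by (rule continuous_on_If) (use assms in auto)
  ultimately show ?thesis by simp
qed

lemma fundamental_group_is_group:
  assumes x: "x \<in> topspace X"
  shows "group (fundamental_group X x)"
proof -
  let ?G = "fundamental_group X x" and ?r = "loop_homotopy X x"
  note E = equiv_loop_homotopy[of X x]
  have car: "A \<in> carrier ?G \<longleftrightarrow> (\<exists>p\<in>loops_at X x. A = ?r `` {p})" for A
    by (auto simp: fundamental_group_def quotient_def)
  have one: "\<one>\<^bsub>?G\<^esub> = ?r `` {\<lambda>_. x}" by (simp add: fundamental_group_def)
  have const: "(\<lambda>_. x) \<in> loops_at X x" using x by (simp add: loops_at_def)
  show ?thesis
  proof (rule groupI)
    show "A \<otimes>\<^bsub>?G\<^esub> B \<in> carrier ?G" if "A \<in> carrier ?G" "B \<in> carrier ?G" for A B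
      using that by (auto simp: car fundamental_group_mult intro: loop_join_in_loops)
    show "\<one>\<^bsub>?G\<^esub> \<in> carrier ?G" using const by (auto simp: car one)
    show "A \<otimes>\<^bsub>?G\<^esub> B \<otimes>\<^bsub>?G\<^esub> C = A \<otimes>\<^bsub>?G\<^esub> (B \<otimes>\<^bsub>?G\<^esub> C)"
      if ABC: "A \<in> carrier ?G" "B \<in> carrier ?G" "C \<in> carrier ?G" for A B C
    proof -
      obtain p q r where pqr: "p \<in> loops_at X x" "q \<in> loops_at X x" "r \<in> loops_at X x"
        "A = ?r `` {p}" "B = ?r `` {q}" "C = ?r `` {r}"
        using ABC unfolding car by blast
      let ?f = "\<lambda>t::real. if t \<le> 1/2 then (if t \<le> 1/4 then 2 * t else t + 1/4) else t/2 + 1/2"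
      have l: "loop_join p (loop_join q r) \<in> loops_at X x"
        using pqr by (intro loop_join_in_loops)
      have c: "continuous_on {0..1} ?f"
        by (intro continuous_on_piecewise continuous_intros) auto
      have q: "loop_join (loop_join p q) r t = loop_join p (loop_join q r) (?f t)" for t
      proof -
        have "2 * (2 * (t + 1/4) - 1) = 2 * (2 * t) - 1" "2 * (t/2 + 1/2) - 1 = t" by auto
        then show ?thesis unfolding loop_join_def by auto
      qed
      have "(loop_join (loop_join p q) r, loop_join p (loop_join q r)) \<in> ?r"
        by (rule loop_homotopy_reparam[where p = "loop_join p (loop_join q r)"
              and f = ?f and g = "\<lambda>t. t"])
          (use l c q in \<open>auto simp: loops_at_def\<close>)
      then show ?thesis
        using pqr by (simp add: fundamental_group_mult loop_join_in_loops equiv_class_eq[OF E])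
    qed
    show "\<one>\<^bsub>?G\<^esub> \<otimes>\<^bsub>?G\<^esub> A = A" if A: "A \<in> carrier ?G" for A
    proof -
      obtain p where p: "p \<in> loops_at X x" "A = ?r `` {p}" using A unfolding car by blast
      let ?f = "\<lambda>t::real. if t \<le> 1/2 then 0 else 2 * t - 1"
      have c: "continuous_on {0..1} ?f"
        by (intro continuous_on_piecewise continuous_intros) auto
      have "(loop_join (\<lambda>_. x) p, p) \<in> ?r"
        by (rule loop_homotopy_reparam[where p = p and f = ?f and g = "\<lambda>t. t"])
          (use p c in \<open>auto simp: loops_at_def loop_join_def\<close>)
      then show ?thesis
        using p const by (simp add: one fundamental_group_mult equiv_class_eq[OF E])
    qed
    show "\<exists>B\<in>carrier ?G. B \<otimes>\<^bsub>?G\<^esub> A = \<one>\<^bsub>?G\<^esub>" if A: "A \<in> carrier ?G" for A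
    proof -
      obtain p where p: "p \<in> loops_at X x" "A = ?r `` {p}" using A unfolding car by blast
      let ?q = "\<lambda>t. p (1 - t)"
      have "(?q, ?q) \<in> ?r"
        by (rule loop_homotopy_reparam[where p = p and f = "\<lambda>t. 1 - t" and g = "\<lambda>t. 1 - t"])
          (use p in \<open>auto simp: loops_at_def intro!: continuous_intros\<close>)
      then have q: "?q \<in> loops_at X x" using E by (auto simp: equiv_def)
      let ?f = "\<lambda>t::real. if t \<le> 1/2 then 1 - 2 * t else 2 * t - 1"
      have c: "continuous_on {0..1} ?f"
        by (intro continuous_on_piecewise continuous_intros) auto
      have "(loop_join ?q p, \<lambda>_. x) \<in> ?r"
        by (rule loop_homotopy_reparam[where p = p and f = ?f and g = "\<lambda>_. 1"])
          (use p c in \<open>auto simp: loops_at_def loop_join_def\<close>)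
      then have "(?r `` {?q}) \<otimes>\<^bsub>?G\<^esub> A = \<one>\<^bsub>?G\<^esub>"
        using p q const by (simp add: one fundamental_group_mult equiv_class_eq[OF E])
      moreover have "?r `` {?q} \<in> carrier ?G"
        unfolding car by (rule bexI[where x = ?q, OF refl q])
      ultimately show ?thesis by (rule bexI)
    qed
  qed
qed

definition graph_braid_group ::
  "nat \<Rightarrow> ('v, 'e) pre_digraph \<Rightarrow> (nat \<Rightarrow> ('v, 'e) graph_point) set \<Rightarrow>
     (real \<Rightarrow> (nat \<Rightarrow> ('v, 'e) graph_point) set) set monoid" where
  "graph_braid_group n G c = fundamental_group (Conf n (graph_space G)) c"

section \<open>Free groups\<close>

text \<open>Words over \<open>S\<close> and its formal inverses; the letter \<open>(s, True)\<close> is \<open>s\<close> and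
  \<open>(s, False)\<close> is its inverse.\<close>

definition free_words :: "'s set \<Rightarrow> ('s \<times> bool) list set" where
  "free_words S = lists (S \<times> UNIV)"

definition free_cancel :: "'s set \<Rightarrow> (('s \<times> bool) list \<times> ('s \<times> bool) list) set" where
  "free_cancel S = {(u @ [(s, b), (s, \<not> b)] @ v, u @ v) | u v s b.
      u \<in> free_words S \<and> v \<in> free_words S \<and> s \<in> S}"

definition free_equiv :: "'s set \<Rightarrow> (('s \<times> bool) list \<times> ('s \<times> bool) list) set" where
  "free_equiv S = Restr ((free_cancel S \<union> (free_cancel S)\<inverse>)\<^sup>*) (free_words S)"

definition free_group :: "'s set \<Rightarrow> ('s \<times> bool) list set monoid" where
  "free_group S =
     \<lparr>carrier = free_words S // free_equiv S,
      mult = (\<lambda>A B. \<Union>u\<in>A. \<Union>v\<in>B. free_equiv S `` {u @ v}),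
      one = free_equiv S `` {[]}\<rparr>"

lemma free_words_append [simp]:
  "u @ v \<in> free_words S \<longleftrightarrow> u \<in> free_words S \<and> v \<in> free_words S"
  by (simp add: free_words_def)

lemma equiv_free_equiv: "equiv (free_words S) (free_equiv S)"
proof -
  have "sym ((free_cancel S \<union> (free_cancel S)\<inverse>)\<^sup>*)"
    by (intro sym_rtrancl sym_Un_converse)
  then show ?thesis
    by (auto simp: free_equiv_def refl_on_def sym_def trans_def intro!: equivI)
qed

lemma free_equiv_cancel:
  assumes "u \<in> free_words S" "v \<in> free_words S" "s \<in> S"
  shows "(u @ [(s, b), (s, \<not> b)] @ v, u @ v) \<in> free_equiv S"
proof -
  have "(u @ [(s, b), (s, \<not> b)] @ v, u @ v) \<in> free_cancel S"
    using assms by (auto simp: free_cancel_def)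
  then show ?thesis
    using assms by (auto simp: free_equiv_def free_words_def)
qed

lemma free_equiv_context:
  assumes "(u, u') \<in> free_equiv S" "w \<in> free_words S" "z \<in> free_words S"
  shows "(w @ u @ z, w @ u' @ z) \<in> free_equiv S"
proof -
  let ?r = "free_cancel S"
  have ctxt: "(w @ x @ z, w @ y @ z) \<in> ?r" if xy: "(x, y) \<in> ?r" for x y
  proof -
    obtain a b s c where "x = a @ [(s, c), (s, \<not> c)] @ b" "y = a @ b"
      "a \<in> free_words S" "b \<in> free_words S" "s \<in> S"
      using xy unfolding free_cancel_def by blast
    then show ?thesis
      unfolding free_cancel_def using assms
      by (intro CollectI exI[of _ "w @ a"] exI[of _ "b @ z"] exI[of _ s] exI[of _ c]) simp
  qed
  have "(u, u') \<in> (?r \<union> ?r\<inverse>)\<^sup>*" using assms by (simp add: free_equiv_def)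
  then have "(w @ u @ z, w @ u' @ z) \<in> (?r \<union> ?r\<inverse>)\<^sup>*"
  proof (induction rule: rtrancl_induct)
    case (step x y)
    then have "(w @ x @ z, w @ y @ z) \<in> ?r \<union> ?r\<inverse>" using ctxt by blast
    with step show ?case by (meson rtrancl.rtrancl_into_rtrancl)
  qed simp
  then show ?thesis using assms by (simp add: free_equiv_def)
qed

lemma free_equiv_append:
  assumes "(u, u') \<in> free_equiv S" "(v, v') \<in> free_equiv S"
  shows "(u @ v, u' @ v') \<in> free_equiv S"
proof -
  have "v \<in> free_words S" "u' \<in> free_words S" "[] \<in> free_words S"
    using assms by (auto simp: free_equiv_def free_words_def)
  then have "(u @ v, u' @ v) \<in> free_equiv S" "(u' @ v, u' @ v') \<in> free_equiv S"
    using free_equiv_context[OF assms(1), of "[]" v] free_equiv_context[OF assms(2), of u' "[]"]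
    by simp_all
  then show ?thesis using equiv_free_equiv[of S] by (meson equiv_def transD)
qed

lemma free_group_mult:
  assumes "u \<in> free_words S" "v \<in> free_words S"
  shows "(free_equiv S `` {u}) \<otimes>\<^bsub>free_group S\<^esub> (free_equiv S `` {v}) = free_equiv S `` {u @ v}"
proof -
  note E = equiv_free_equiv[of S]
  have "congruent2 (free_equiv S) (free_equiv S) (\<lambda>u v. free_equiv S `` {u @ v})"
    unfolding congruent2_def by (auto intro!: equiv_class_eq[OF E] free_equiv_append)
  from UN_equiv_class2[OF E E this assms] show ?thesis
    by (simp add: free_group_def)
qed

lemma free_word_inverse:
  assumes "u \<in> free_words S"
  shows "\<exists>v\<in>free_words S. (v @ u, []) \<in> free_equiv S"
  using assms
proof (induction u)
  case Nil
  then show ?case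
    using equiv_free_equiv[of S] by (intro bexI[of _ "[]"]) (auto simp: equiv_def refl_on_def)
next
  case (Cons a u)
  obtain s b where a: "a = (s, b)" by (cases a)
  have u: "u \<in> free_words S" "s \<in> S" using Cons.prems by (auto simp: free_words_def a)
  obtain v where v: "v \<in> free_words S" "(v @ u, []) \<in> free_equiv S" using Cons.IH u by blast
  have "((v @ [(s, \<not> b)]) @ a # u, v @ u) \<in> free_equiv S"
    using free_equiv_cancel[OF v(1) u, of "\<not> b"] by (simp add: a)
  then have "((v @ [(s, \<not> b)]) @ a # u, []) \<in> free_equiv S"
    using v(2) equiv_free_equiv[of S] by (meson equiv_def transD)
  moreover have "v @ [(s, \<not> b)] \<in> free_words S" using v u by (simp add: free_words_def)
  ultimately show ?case by blast
qed

lemma free_group_is_group: "group (free_group S)"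
proof (rule groupI)
  let ?G = "free_group S" and ?r = "free_equiv S"
  have car: "A \<in> carrier ?G \<longleftrightarrow> (\<exists>u\<in>free_words S. A = ?r `` {u})" for A
    by (auto simp: free_group_def quotient_def)
  have one: "\<one>\<^bsub>?G\<^esub> = ?r `` {[]}" by (simp add: free_group_def)
  have nil: "[] \<in> free_words S" by (simp add: free_words_def)
  show "A \<otimes>\<^bsub>?G\<^esub> B \<in> carrier ?G" if "A \<in> carrier ?G" "B \<in> carrier ?G" for A B
    using that by (auto simp: car free_group_mult)
  show "\<one>\<^bsub>?G\<^esub> \<in> carrier ?G" using nil by (auto simp: car one)
  show "A \<otimes>\<^bsub>?G\<^esub> B \<otimes>\<^bsub>?G\<^esub> C = A \<otimes>\<^bsub>?G\<^esub> (B \<otimes>\<^bsub>?G\<^esub> C)"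
    if "A \<in> carrier ?G" "B \<in> carrier ?G" "C \<in> carrier ?G" for A B C
    using that by (auto simp: car free_group_mult)
  show "\<one>\<^bsub>?G\<^esub> \<otimes>\<^bsub>?G\<^esub> A = A" if "A \<in> carrier ?G" for A
    using that nil by (auto simp: car one free_group_mult)
  show "\<exists>B\<in>carrier ?G. B \<otimes>\<^bsub>?G\<^esub> A = \<one>\<^bsub>?G\<^esub>" if A: "A \<in> carrier ?G" for A
  proof -
    obtain u where u: "u \<in> free_words S" "A = ?r `` {u}" using A unfolding car by blast
    obtain v where v: "v \<in> free_words S" "(v @ u, []) \<in> ?r" using free_word_inverse[OF u(1)] by blast
    have "(?r `` {v}) \<otimes>\<^bsub>?G\<^esub> A = \<one>\<^bsub>?G\<^esub>"
      using u v equiv_class_eq[OF equiv_free_equiv v(2)] by (simp add: one free_group_mult)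
    moreover have "?r `` {v} \<in> carrier ?G"
      unfolding car by (rule bexI[where x = v, OF refl v(1)])
    ultimately show ?thesis by (rule bexI)
  qed
qed

text \<open>
  A basis of a free group \<open>G\<close> is a subset of the carrier, so it is no restriction to take the
  generators from the element type of \<open>G\<close>.
\<close>

definition is_free_group :: "('a, 'm) monoid_scheme \<Rightarrow> bool" where
  "is_free_group G \<longleftrightarrow> (\<exists>S :: 'a set. free_group S \<cong> G)"

section \<open>Pulsar graphs\<close>

datatype pulsar_vertex = Hub1 | Hub2 | Tip1 nat | Tip2 nat

datatype pulsar_edge = Arc nat | Ray1 nat | Ray2 nat

text \<open>\<open>Hub1\<close> and \<open>Hub2\<close> are the vertices \<open>a\<^sub>1\<close> and \<open>a\<^sub>2\<close> of the theta graph formed by the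
  edges \<open>Arc i\<close>; the tips are the degree-one ends of the rays.\<close>

definition pulsar :: "nat \<Rightarrow> nat \<Rightarrow> nat \<Rightarrow> (pulsar_vertex, pulsar_edge) pre_digraph" where
  "pulsar m n1 n2 =
     \<lparr>verts = {Hub1, Hub2} \<union> Tip1 ` {..<n1} \<union> Tip2 ` {..<n2},
      arcs = Arc ` {..<m} \<union> Ray1 ` {..<n1} \<union> Ray2 ` {..<n2},
      tail = (\<lambda>e. case e of Arc _ \<Rightarrow> Hub1 | Ray1 _ \<Rightarrow> Hub1 | Ray2 _ \<Rightarrow> Hub2),
      head = (\<lambda>e. case e of Arc _ \<Rightarrow> Hub2 | Ray1 j \<Rightarrow> Tip1 j | Ray2 j \<Rightarrow> Tip2 j)\<rparr>"

lemma fin_digraph_pulsar: "fin_digraph (pulsar m n1 n2)"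
  by unfold_locales (auto simp: pulsar_def)

end

theory Submission
  imports Defs "HOL-Library.Z2"
begin

text \<open>
  Let \<open>G\<close> be a group with two homomorphisms \<open>\<phi>\<close>, \<open>\<psi>\<close> to the group of order two.  If \<open>G\<close> is
  free, then \<open>(\<phi>, \<psi>)\<close> lifts to the dihedral group of order eight, which is a central extension
  of the Klein four-group, and the remaining coordinate of a lift is a function \<open>B\<close> with
  \<open>B (x y) = B x + B y + \<phi> x * \<psi> y\<close>: the cup product of \<open>\<phi>\<close> and \<open>\<psi>\<close> is the coboundary of \<open>B\<close>
  (\<open>free_group_central_extension\<close>).  For the fundamental group of a space \<open>X\<close> such a \<open>B\<close>
  transfers to a function of paths between chosen points of \<open>X\<close>
  (\<open>free_fundamental_group_cochain\<close>).  Its values cancel when they are summed over the squares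
  of a closed square-tiled surface mapped to \<open>X\<close>, so the cup product evaluates to zero on every
  such surface.  It therefore suffices to find a surface in the configuration space, and two
  classes, for which the evaluation is one.
  
  The surface uses the arcs \<open>0, 1, 2, 3\<close>.  Its eight vertices are indexed by the subsets \<open>T\<close> of
  \<open>{1, 2, 3}\<close>: one particle is parked in the middle of arc \<open>j\<close> for each \<open>j \<in> T\<close>, and the others
  sit on arc \<open>0\<close>.  For \<open>j \<notin> T\<close> there are two ways to reach \<open>T \<union> {j}\<close>: the move \<open>U j\<close> takes the
  particle of arc \<open>0\<close> closest to \<open>Hub1\<close> through \<open>Hub1\<close> to arc \<open>j\<close>, and \<open>D j\<close> takes the one closest
  to \<open>Hub2\<close> through \<open>Hub2\<close>.  For \<open>j \<noteq> k\<close> the moves \<open>U j\<close> and \<open>D k\<close> happen at different hubs and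
  can be carried out simultaneously, which fills in a square (\<open>square_from_bottom\<close> for \<open>T\<close>
  empty, \<open>square_to_top\<close> for \<open>T\<close> a singleton).  These \<open>12\<close> squares have \<open>24\<close> edges, each on
  exactly two squares, so they form a closed surface of Euler characteristic
  \<open>8 - 24 + 12 = -4\<close>.
  
  The class \<open>\<phi>\<close> counts modulo two how often particles run through arc \<open>0\<close>, and \<open>\<psi>\<close> is the sign of
  the induced permutation of the particles.  Both are monodromies of a continuous square root:
  of a product of phases for \<open>\<phi>\<close>, and of the discriminant of the three points under a planar
  embedding for \<open>\<psi>\<close>.  With suitable roots at the vertices, \<open>\<phi>\<close> vanishes on every \<open>U\<close> and is one
  on every \<open>D\<close>, so each square contributes the value of \<open>\<psi>\<close> on the \<open>U j\<close> that follows \<open>D k\<close>.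
  The edges \<open>U j\<close> that start with two parked particles occur twice and cancel, and the sum that
  remains runs over the moves \<open>U j\<close> with one particle parked on an arc \<open>k \<noteq> j\<close>
  (\<open>parity_sum\<close>).  Exchanging \<open>j\<close> and \<open>k\<close> leads to the same final configuration with two
  particles interchanged, so each of the three pairs contributes one, and the total is one.
\<close>

section \<open>Free groups and central extensions by the group of order two\<close>

lemma bit_double [simp]: "x + x = (0::bit)"
  by (cases x) simp_all

lemma bit_double_left [simp]: "x + (x + y) = (y::bit)"
  by (cases x; cases y) simp_all

text \<open>
  Prescribing the lift on generators determines it on words; here \<open>A\<close> is the central
  coordinate of the lifted word.  Generators are given central coordinate \<open>0\<close>.
\<close>

lemma free_group_central_extension:
  fixes \<phi> \<psi> :: "'a \<Rightarrow> bit"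
  assumes free: "is_free_group G"
    and \<phi>: "\<And>x y. x \<in> carrier G \<Longrightarrow> y \<in> carrier G \<Longrightarrow> \<phi> (x \<otimes>\<^bsub>G\<^esub> y) = \<phi> x + \<phi> y"
    and \<psi>: "\<And>x y. x \<in> carrier G \<Longrightarrow> y \<in> carrier G \<Longrightarrow> \<psi> (x \<otimes>\<^bsub>G\<^esub> y) = \<psi> x + \<psi> y"
  obtains B :: "'a \<Rightarrow> bit"
  where "\<And>x y. x \<in> carrier G \<Longrightarrow> y \<in> carrier G \<Longrightarrow> B (x \<otimes>\<^bsub>G\<^esub> y) = B x + B y + \<phi> x * \<psi> y"
proof -
  obtain S :: "'a set" and h where h: "h \<in> iso (free_group S) G"
    using free by (auto simp: is_free_group_def is_iso_def)
  define W where "W = free_words S"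
  define c where "c u = h (free_equiv S `` {u})" for u
  define f where "f u = \<phi> (c u)" for u
  define g where "g u = \<psi> (c u)" for u
  note E = equiv_free_equiv[of S]
  have c_carrier: "c u \<in> carrier G" if "u \<in> W" for u
  proof -
    have "free_equiv S `` {u} \<in> carrier (free_group S)"
      using that by (auto simp: free_group_def W_def quotient_def)
    then show ?thesis using h by (auto simp: iso_def hom_def c_def)
  qed
  have c_append: "c (u @ v) = c u \<otimes>\<^bsub>G\<^esub> c v" if "u \<in> W" "v \<in> W" for u v
  proof -
    have "free_equiv S `` {u} \<in> carrier (free_group S)" "free_equiv S `` {v} \<in> carrier (free_group S)"
      using that by (auto simp: free_group_def W_def quotient_def)
    then show ?thesis using h that
      by (simp add: iso_def hom_def c_def W_def flip: free_group_mult)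
  qed
  have c_surj: "\<exists>u\<in>W. c u = x" if "x \<in> carrier G" for x
  proof -
    have "x \<in> h ` carrier (free_group S)"
      using h that by (simp add: iso_def bij_betw_def)
    then show ?thesis by (auto simp: free_group_def quotient_def W_def c_def)
  qed
  have c_eq: "(u, v) \<in> free_equiv S" if "u \<in> W" "v \<in> W" "c u = c v" for u v
  proof -
    have "inj_on h (carrier (free_group S))" using h by (simp add: iso_def bij_betw_def)
    then have "free_equiv S `` {u} = free_equiv S `` {v}"
      using that by (auto simp: inj_on_def free_group_def quotient_def W_def c_def)
    then show ?thesis using eq_equiv_class[OF _ E] that by (simp add: W_def)
  qed
  have W: "[] \<in> W" "\<And>u v. u @ v \<in> W \<longleftrightarrow> u \<in> W \<and> v \<in> W"
    "\<And>s b u. (s, b) # u \<in> W \<longleftrightarrow> s \<in> S \<and> u \<in> W"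
    by (auto simp: W_def free_words_def)
  have f: "f (u @ v) = f u + f v" and g: "g (u @ v) = g u + g v" if "u \<in> W" "v \<in> W" for u v
    using that by (simp_all add: f_def g_def c_append c_carrier \<phi> \<psi>)
  have f0: "f [] = 0" and g0: "g [] = 0"
    using f[of "[]" "[]"] g[of "[]" "[]"] W(1) by simp_all
  have c_cancel: "c [(s, b), (s, \<not> b)] = c []" if "s \<in> S" for s b
    using free_equiv_cancel[of "[]" S "[]" s b] that equiv_class_eq[OF E]
    by (simp add: c_def free_words_def)
  have f1: "f [(s, \<not> b)] = f [(s, b)]" and g1: "g [(s, \<not> b)] = g [(s, b)]" if "s \<in> S" for s b
  proof -
    have "f [(s, b)] + f [(s, \<not> b)] = 0" "g [(s, b)] + g [(s, \<not> b)] = 0"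
      using f[of "[(s, b)]" "[(s, \<not> b)]"] g[of "[(s, b)]" "[(s, \<not> b)]"] that W c_cancel[of s b]
        f0 g0 by (simp_all add: f_def g_def)
    then show "f [(s, \<not> b)] = f [(s, b)]" "g [(s, \<not> b)] = g [(s, b)]"
      by (metis add.right_neutral bit_double_left)+
  qed
  \<comment> \<open>The inverse of \<open>(p, q, 0)\<close> in the extension is \<open>(p, q, p * q)\<close>.\<close>
  define \<beta> where "\<beta> l = (if snd l then 0 else f [l] * g [l])" for l
  define A where "A = rec_list 0 (\<lambda>l u a. \<beta> l + a + f [l] * g u)"
  have A: "A [] = 0" "A (l # u) = \<beta> l + A u + f [l] * g u" for l u
    by (simp_all add: A_def)
  have A_append: "A (u @ v) = A u + A v + f u * g v" if "u \<in> W" "v \<in> W" for u v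
    using that
  proof (induction u)
    case (Cons l u)
    obtain s b where l: "l = (s, b)" by (cases l)
    have u: "u \<in> W" "[l] \<in> W" using Cons.prems W by (auto simp: l)
    show ?case
      using Cons.IH[OF u(1) Cons.prems(2)] g[OF u(1) Cons.prems(2)] f[OF u(2,1)]
      by (simp only: A append_Cons append_Nil distrib_left distrib_right ac_simps)
  qed (simp add: A f0)
  have A_cancel: "A [(s, b), (s, \<not> b)] = 0" if "s \<in> S" for s b
    using f1[OF that, of b] g1[OF that, of b] by (cases b) (simp_all add: A g0 \<beta>_def)
  have A_free_cancel: "A u = A v" if "(u, v) \<in> free_cancel S" for u v
  proof -
    obtain x y s b where uv: "u = x @ [(s, b), (s, \<not> b)] @ y" "v = x @ y" "x \<in> W" "y \<in> W" "s \<in> S"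
      using \<open>(u, v) \<in> free_cancel S\<close> unfolding free_cancel_def W_def by blast
    have 1: "[(s, b), (s, \<not> b)] \<in> W" using uv W by simp
    then have 2: "[(s, b), (s, \<not> b)] @ y \<in> W" using uv W(2) by blast
    have z: "f [(s, b), (s, \<not> b)] = 0" "g [(s, b), (s, \<not> b)] = 0"
      using c_cancel[OF \<open>s \<in> S\<close>] f0 g0 by (simp_all add: f_def g_def)
    show ?thesis
      unfolding uv(1,2) A_append[OF \<open>x \<in> W\<close> 2] A_append[OF 1 \<open>y \<in> W\<close>] A_append[OF \<open>x \<in> W\<close> \<open>y \<in> W\<close>]
        g[OF 1 \<open>y \<in> W\<close>] z A_cancel[OF \<open>s \<in> S\<close>] by simp
  qed
  have A_equiv: "A u = A v" if "(u, v) \<in> free_equiv S" for u v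
  proof -
    have "(u, v) \<in> (free_cancel S \<union> (free_cancel S)\<inverse>)\<^sup>*" using that by (simp add: free_equiv_def)
    then show ?thesis
      by (induction rule: rtrancl_induct) (auto dest: A_free_cancel)
  qed
  define B where "B x = A (SOME u. u \<in> W \<and> c u = x)" for x
  have B: "B (c u) = A u" if "u \<in> W" for u
  proof -
    have "(SOME v. v \<in> W \<and> c v = c u) \<in> W \<and> c (SOME v. v \<in> W \<and> c v = c u) = c u"
      by (rule someI[of _ u]) (use that in simp)
    then show ?thesis unfolding B_def by (intro A_equiv c_eq) (use that in auto)
  qed
  show thesis
  proof
    fix x y assume "x \<in> carrier G" "y \<in> carrier G"
    then obtain u v where uv: "u \<in> W" "c u = x" "v \<in> W" "c v = y" using c_surj by blast
    then show "B (x \<otimes>\<^bsub>G\<^esub> y) = B x + B y + \<phi> x * \<psi> y"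
      using B[of "u @ v"] B[of u] B[of v] A_append[of u v] W(2) by (auto simp: c_append f_def g_def)
  qed
qed

section \<open>Homotopies of paths relative to their ends\<close>

definition path_homotopic :: "'a topology \<Rightarrow> (real \<Rightarrow> 'a) \<Rightarrow> (real \<Rightarrow> 'a) \<Rightarrow> bool" where
  "path_homotopic X p q \<longleftrightarrow>
     homotopic_with (\<lambda>r. r 0 = p 0 \<and> r 1 = p 1) (top_of_set {0..1}) X p q"

definition reverse_path :: "(real \<Rightarrow> 'a) \<Rightarrow> real \<Rightarrow> 'a" where
  "reverse_path p = (\<lambda>t. p (1 - t))"

lemma loop_join_ends [simp]: "loop_join p q 0 = p 0" "loop_join p q 1 = q 1"
  by (simp_all add: loop_join_def)

lemma reverse_path_ends [simp]: "reverse_path p 0 = p 1" "reverse_path p 1 = p 0"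
  by (simp_all add: reverse_path_def)

lemma path_homotopic_iff:
  fixes X :: "'a topology"
  shows "path_homotopic X p q \<longleftrightarrow>
     (\<exists>h :: real \<times> real \<Rightarrow> 'a. continuous_map (top_of_set ({0..1} \<times> {0..1})) X h \<and>
          (\<forall>t\<in>{0..1}. h (0, t) = p t) \<and> (\<forall>t\<in>{0..1}. h (1, t) = q t) \<and>
          (\<forall>s\<in>{0..1}. h (s, 0) = p 0 \<and> h (s, 1) = p 1))"
proof -
  have "prod_topology (top_of_set {0..1::real}) (top_of_set {0..1::real}) =
          top_of_set ({0..1} \<times> {0..1})"
    by simp
  then show ?thesis
    unfolding path_homotopic_def by (simp add: homotopic_with)
qed

lemma path_homotopic_ends:
  assumes "path_homotopic X p q" shows "q 0 = p 0" "q 1 = p 1"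
  using homotopic_with_imp_property[OF assms[unfolded path_homotopic_def]] by auto

lemma path_homotopic_pathin:
  assumes "path_homotopic X p q" shows "pathin X p" "pathin X q"
  using homotopic_with_imp_continuous_maps[OF assms[unfolded path_homotopic_def]]
  by (auto simp: pathin_def)

lemma path_homotopic_refl: "pathin X p \<Longrightarrow> path_homotopic X p p"
  by (simp add: path_homotopic_def pathin_def)

lemma path_homotopic_sym: "path_homotopic X p q \<Longrightarrow> path_homotopic X q p"
  using path_homotopic_ends[of X p q] unfolding path_homotopic_def
  by (auto intro: homotopic_with_symD)

lemma path_homotopic_trans [trans]:
  "path_homotopic X p q \<Longrightarrow> path_homotopic X q r \<Longrightarrow> path_homotopic X p r"
  using path_homotopic_ends[of X p q] unfolding path_homotopic_def
  by (auto intro: homotopic_with_trans)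

lemma loop_homotopy_iff_path_homotopic:
  "(p, q) \<in> loop_homotopy X x \<longleftrightarrow> path_homotopic X p q \<and> p 0 = x \<and> p 1 = x"
proof
  assume L: "(p, q) \<in> loop_homotopy X x"
  then have "p 0 = x \<and> p 1 = x"
    unfolding loop_homotopy_def by (auto dest: homotopic_with_imp_property)
  with L show "path_homotopic X p q \<and> p 0 = x \<and> p 1 = x"
    by (auto simp: loop_homotopy_def path_homotopic_def)
qed (auto simp: loop_homotopy_def path_homotopic_def)

text \<open>
  Straight-line homotopies in a convex parameter domain give all homotopies that are needed:
  reparametrisations come from an interval and commuting squares from a square.
\<close>

lemma path_homotopic_through_convex:
  fixes K :: "'e::real_normed_vector set"
  assumes F: "continuous_map (top_of_set K) X F" and K: "convex K"
    and f: "continuous_on {0..1} f" "f ` {0..1} \<subseteq> K"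
    and g: "continuous_on {0..1} g" "g ` {0..1} \<subseteq> K"
    and ends: "f 0 = g 0" "f 1 = g 1"
    and p: "\<And>t. t \<in> {0..1} \<Longrightarrow> p t = F (f t)" and q: "\<And>t. t \<in> {0..1} \<Longrightarrow> q t = F (g t)"
  shows "path_homotopic X p q"
proof -
  let ?k = "\<lambda>z::real \<times> real. (1 - fst z) *\<^sub>R f (snd z) + fst z *\<^sub>R g (snd z)"
  have "continuous_on ({0..1} \<times> {0..1}) ?k"
    by (intro continuous_intros continuous_on_compose2[OF f(1)] continuous_on_compose2[OF g(1)])
      auto
  moreover have "?k z \<in> K" if "z \<in> {0..1} \<times> {0..1}" for z
    by (rule convexD[OF K]) (use f g that in auto)
  ultimately have "continuous_map (top_of_set ({0..1} \<times> {0..1})) (top_of_set K) ?k"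
    by auto
  from continuous_map_compose[OF this F]
  show ?thesis
    unfolding path_homotopic_iff
    by (intro exI[of _ "F \<circ> ?k"]) (use ends p q in \<open>auto simp flip: scaleR_left_distrib\<close>)
qed

lemma path_homotopic_reparam:
  assumes p: "pathin X p"
    and "continuous_on {0..1} f" "f ` {0..1} \<subseteq> {0..1}"
    and "continuous_on {0..1} g" "g ` {0..1} \<subseteq> {0..1}"
    and "f 0 = g 0" "f 1 = g 1"
    and "\<And>t. t \<in> {0..1} \<Longrightarrow> q t = p (f t)" and "\<And>t. t \<in> {0..1} \<Longrightarrow> r t = p (g t)"
  shows "path_homotopic X q r"
  by (rule path_homotopic_through_convex[OF p[unfolded pathin_def] convex_real_interval(5)])
    (use assms in auto)

lemma path_homotopic_join:
  assumes "path_homotopic X p p'" "path_homotopic X q q'" "p 1 = q 0"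
  shows "path_homotopic X (loop_join p q) (loop_join p' q')"
proof -
  let ?S = "{0..1::real} \<times> {0..1::real}"
  obtain h where h: "continuous_map (top_of_set ?S) X h"
    "\<forall>t\<in>{0..1}. h (0, t) = p t" "\<forall>t\<in>{0..1}. h (1, t) = p' t"
    "\<forall>s\<in>{0..1}. h (s, 0) = p 0 \<and> h (s, 1) = p 1"
    using assms(1) unfolding path_homotopic_iff by blast
  obtain k where k: "continuous_map (top_of_set ?S) X k"
    "\<forall>t\<in>{0..1}. k (0, t) = q t" "\<forall>t\<in>{0..1}. k (1, t) = q' t"
    "\<forall>s\<in>{0..1}. k (s, 0) = q 0 \<and> k (s, 1) = q 1"
    using assms(2) unfolding path_homotopic_iff by blast
  define H where "H = (\<lambda>z. if snd z \<le> 1/2 then (h \<circ> (\<lambda>z. (fst z, 2 * snd z))) z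
                              else (k \<circ> (\<lambda>z. (fst z, 2 * snd z - 1))) z)"
  have "continuous_map (top_of_set ?S) X H"
    unfolding H_def
  proof (rule continuous_map_cases_le)
    show "continuous_map (subtopology (top_of_set ?S) {z \<in> topspace (top_of_set ?S). snd z \<le> 1/2})
            X (h \<circ> (\<lambda>z. (fst z, 2 * snd z)))"
      by (rule continuous_map_compose[OF _ h(1)])
        (auto simp: subtopology_subtopology intro!: continuous_intros)
    show "continuous_map (subtopology (top_of_set ?S) {z \<in> topspace (top_of_set ?S). 1/2 \<le> snd z})
            X (k \<circ> (\<lambda>z. (fst z, 2 * snd z - 1)))"
      by (rule continuous_map_compose[OF _ k(1)])
        (auto simp: subtopology_subtopology intro!: continuous_intros)
    show "(h \<circ> (\<lambda>z. (fst z, 2 * snd z))) z = (k \<circ> (\<lambda>z. (fst z, 2 * snd z - 1))) z"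
      if "z \<in> topspace (top_of_set ?S)" "snd z = 1/2" for z
    proof -
      have "2 * snd z = 1" "2 * snd z - 1 = 0" using that by simp_all
      then show ?thesis
        using that h(4) k(4) \<open>p 1 = q 0\<close>
        by (simp only: o_apply topspace_euclidean_subtopology mem_Times_iff)
    qed
  qed (auto intro!: continuous_intros)
  then show ?thesis
    unfolding path_homotopic_iff
    by (intro exI[of _ H]) (use h k in \<open>auto simp: H_def loop_join_def\<close>)
qed

lemma pathin_loop_join:
  assumes "pathin X p" "pathin X q" "p 1 = q 0"
  shows "pathin X (loop_join p q)"
  using path_homotopic_join[of X p p q q] assms path_homotopic_refl path_homotopic_pathin(1) by blast

lemma pathin_reverse_path:
  assumes "pathin X p" shows "pathin X (reverse_path p)"
proof -
  have "continuous_map (top_of_set {0..1}) (top_of_set {0..1}) (\<lambda>t::real. 1 - t)"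
    by (auto intro!: continuous_intros)
  from continuous_map_compose[OF this assms[unfolded pathin_def]] show ?thesis
    by (simp add: pathin_def reverse_path_def o_def)
qed

lemma path_homotopic_assoc:
  assumes "pathin X p" "pathin X q" "pathin X r" "p 1 = q 0" "q 1 = r 0"
  shows "path_homotopic X (loop_join (loop_join p q) r) (loop_join p (loop_join q r))"
proof -
  let ?f = "\<lambda>t::real. if t \<le> 1/2 then (if t \<le> 1/4 then 2 * t else t + 1/4) else t/2 + 1/2"
  have l: "pathin X (loop_join p (loop_join q r))"
    using assms by (intro pathin_loop_join) simp_all
  have c: "continuous_on {0..1} ?f"
    by (intro continuous_on_piecewise continuous_intros) auto
  have q: "loop_join (loop_join p q) r t = loop_join p (loop_join q r) (?f t)" for t
  proof -
    have "2 * (2 * (t + 1/4) - 1) = 2 * (2 * t) - 1" "2 * (t/2 + 1/2) - 1 = t" by auto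
    then show ?thesis unfolding loop_join_def by auto
  qed
  show ?thesis
    by (rule path_homotopic_reparam[where f = ?f and g = "\<lambda>t. t", OF l]) (use c q in auto)
qed

text \<open>
  Cancellation is stated with a further path attached so that it is a reparametrisation of
  \<open>loop_join p q\<close> alone: the parameter runs back to the start of \<open>p\<close> and then forward again.
\<close>

lemma path_homotopic_cancel:
  assumes p: "pathin X p" and q: "pathin X q" and "p 1 = q 0"
  shows "path_homotopic X (loop_join (reverse_path p) (loop_join p q)) q"
proof -
  let ?g = "\<lambda>t::real. t / 2 + 1 / 2"
  let ?r = "loop_join p q"
  have l: "pathin X ?r" using assms by (rule pathin_loop_join)
  let ?f = "\<lambda>t::real. if t \<le> 1/2 then 1/2 - t else 2 * t - 1"
  have c: "continuous_on {0..1} ?f"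
    by (intro continuous_on_piecewise continuous_intros) auto
  have e: "loop_join (reverse_path p) ?r t = ?r (?f t)" if "t \<in> {0..1}" for t
  proof (cases "t \<le> 1/2")
    case True
    then have "2 * (1/2 - t) = 1 - 2 * t" by simp
    then show ?thesis using True that unfolding loop_join_def reverse_path_def by simp
  qed (simp add: loop_join_def)
  have e': "q t = ?r (?g t)" if "t \<in> {0..1}" for t
  proof (cases "t = 0")
    case False
    then have "\<not> ?g t \<le> 1/2" "2 * ?g t - 1 = t" using that by auto
    then show ?thesis unfolding loop_join_def by simp
  qed (simp add: loop_join_def \<open>p 1 = q 0\<close>)
  have "continuous_on {0..1} ?g" by (intro continuous_intros) simp
  moreover have "?f ` {0..1} \<subseteq> {0..1}" "?g ` {0..1} \<subseteq> {0..1}" by auto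
  ultimately show ?thesis
    using path_homotopic_reparam[OF l c, of ?g] e e' by simp
qed

lemma path_homotopic_square:
  fixes H :: "real \<times> real \<Rightarrow> 'a"
  assumes H: "continuous_map (top_of_set ({0..1} \<times> {0..1})) X H"
    and sides: "\<And>t. t \<in> {0..1} \<Longrightarrow> a t = H (t, 0)" "\<And>t. t \<in> {0..1} \<Longrightarrow> b t = H (1, t)"
      "\<And>t. t \<in> {0..1} \<Longrightarrow> a' t = H (0, t)" "\<And>t. t \<in> {0..1} \<Longrightarrow> b' t = H (t, 1)"
  shows "path_homotopic X (loop_join a b) (loop_join a' b')"
proof -
  let ?f = "\<lambda>t::real. (min 1 (2 * t), max 0 (2 * t - 1))"
  let ?g = "\<lambda>t::real. (max 0 (2 * t - 1), min 1 (2 * t))"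
  have "loop_join a b t = H (?f t)" "loop_join a' b' t = H (?g t)" if "t \<in> {0..1}" for t
    using that by (cases "t \<le> 1/2"; simp add: loop_join_def sides)+
  moreover have "continuous_on {0..1} ?f" "continuous_on {0..1} ?g"
    by (intro continuous_intros)+
  moreover have "?f ` {0..1} \<subseteq> {0..1} \<times> {0..1}" "?g ` {0..1} \<subseteq> {0..1} \<times> {0..1}" by auto
  moreover have "convex ({0..1::real} \<times> {0..1::real})" by (intro convex_Times) auto
  ultimately show ?thesis
    by (intro path_homotopic_through_convex[OF H, of ?f ?g]) auto
qed

section \<open>Monodromy of a double cover\<close>

definition sqrt_along :: "('a \<Rightarrow> complex) \<Rightarrow> (real \<Rightarrow> 'a) \<Rightarrow> (real \<Rightarrow> complex) \<Rightarrow> bool" where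
  "sqrt_along F p S \<longleftrightarrow> continuous_on {0..1} S \<and> (\<forall>t\<in>{0..1}. (S t)\<^sup>2 = F (p t))"

text \<open>
  The equation \<open>z\<^sup>2 = F x\<close> describes a double cover.  Transport along a path takes a root \<open>a\<close> at
  its start to one of the two roots at its end, and the value records whether this is \<open>b\<close> or
  \<open>-b\<close>.  Making the roots at the ends explicit gives values for paths that are not closed,
  which are additive under concatenation.
\<close>

definition sheet_change :: "('a \<Rightarrow> complex) \<Rightarrow> complex \<Rightarrow> (real \<Rightarrow> 'a) \<Rightarrow> complex \<Rightarrow> bit" where
  "sheet_change F a p b = (if \<exists>S. sqrt_along F p S \<and> S 0 = a \<and> S 1 = b then 0 else 1)"

lemma continuous_sqrt_unique:
  fixes S S' :: "'b::topological_space \<Rightarrow> complex"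
  assumes "connected K" "continuous_on K S" "continuous_on K S'"
    and "\<And>x. x \<in> K \<Longrightarrow> (S x)\<^sup>2 = (S' x)\<^sup>2" "\<And>x. x \<in> K \<Longrightarrow> S' x \<noteq> 0"
    and "x \<in> K" "S x = S' x" "y \<in> K"
  shows "S y = S' y"
proof -
  let ?q = "\<lambda>x. S x / S' x"
  have "?q z \<in> {1, -1}" if "z \<in> K" for z
    using assms(4,5)[OF that] by (auto simp: power2_eq_iff)
  then have "finite (?q ` K)" by (meson finite.simps finite_subset image_subsetI)
  moreover have "continuous_on K ?q"
    using assms by (auto intro!: continuous_intros)
  ultimately have "?q constant_on K"
    using assms(1) by (intro continuous_finite_range_constant)
  then have "?q y = ?q x" using assms(6,8) by (auto simp: constant_on_def)
  then show ?thesis using assms(5)[OF \<open>x \<in> K\<close>] assms(5)[OF \<open>y \<in> K\<close>] \<open>S x = S' x\<close>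
    by (simp add: field_simps)
qed

locale nonvanishing_map =
  fixes X :: "'a topology" and F :: "'a \<Rightarrow> complex"
  assumes continuous_map: "continuous_map X euclidean F"
    and nonzero: "x \<in> topspace X \<Longrightarrow> F x \<noteq> 0"
begin

lemma sqrt_along_unique:
  assumes "pathin X p" "sqrt_along F p S" "sqrt_along F p S'" "S 0 = S' 0"
  shows "S 1 = S' 1"
proof (rule continuous_sqrt_unique[of "{0..1}" S S' 0])
  fix t :: real assume t: "t \<in> {0..1}"
  then have "p t \<in> topspace X" using assms(1) by (auto simp: pathin_def continuous_map_def)
  then have "(S' t)\<^sup>2 \<noteq> 0" using nonzero assms(3) t by (auto simp: sqrt_along_def)
  then show "S' t \<noteq> 0" by auto
qed (use assms in \<open>auto simp: sqrt_along_def\<close>)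

lemma sqrt_along_exists:
  assumes p: "pathin X p" and a: "a\<^sup>2 = F (p 0)"
  obtains S where "sqrt_along F p S" "S 0 = a"
proof -
  have "continuous_map (top_of_set {0..1}) euclidean (F \<circ> p)"
    by (rule continuous_map_compose[OF p[unfolded pathin_def] continuous_map])
  then have "continuous_on {0..1} (\<lambda>t. F (p t))" by (simp add: o_def)
  moreover have "F (p t) \<noteq> 0" if "t \<in> {0..1}" for t
    using p that by (intro nonzero) (auto simp: pathin_def continuous_map_def)
  ultimately obtain S where S: "continuous_on {0..1} S" "\<And>t. t \<in> {0..1} \<Longrightarrow> F (p t) = (S t)\<^sup>2"
    using continuous_sqrt_on_contractible[of "{0..1}" "\<lambda>t. F (p t)"]
      convex_imp_contractible[OF convex_real_interval(5)[of 0 1]] by blast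
  then have sq: "sqrt_along F p S" "sqrt_along F p (\<lambda>t. - S t)"
    using continuous_on_minus[OF S(1)] by (simp_all add: sqrt_along_def)
  have "a\<^sup>2 = (S 0)\<^sup>2" using a S(2)[of 0] by simp
  then have "a = S 0 \<or> a = - S 0" by (simp only: power2_eq_iff)
  then show thesis using that[OF sq(1)] that[OF sq(2)] by blast
qed

lemma nonzero_root:
  assumes "pathin X p" "t \<in> {0..1}" "b\<^sup>2 = F (p t)"
  shows "b \<noteq> 0"
proof -
  have "p t \<in> topspace X" using assms(1,2) by (auto simp: pathin_def continuous_map_def)
  then show ?thesis using nonzero assms(3) by force
qed

lemma sheet_change_eqI:
  assumes p: "pathin X p" and S: "sqrt_along F p S" "S 0 = a"
    and b: "b\<^sup>2 = F (p 1)" "S 1 = (if \<epsilon> = 0 then b else - b)"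
  shows "sheet_change F a p b = \<epsilon>"
proof (cases "\<epsilon> = 0")
  case False
  have "b \<noteq> 0" using nonzero_root[OF p, of 1] b(1) by simp
  then have "S 1 \<noteq> b" using False b(2) by simp
  then have "\<nexists>T. sqrt_along F p T \<and> T 0 = a \<and> T 1 = b"
    using sqrt_along_unique[OF p S(1)] S(2) by metis
  then show ?thesis using False unfolding sheet_change_def by simp
next
  case True
  then show ?thesis using S b(2) unfolding sheet_change_def by auto
qed

lemma sheet_change_lift:
  assumes p: "pathin X p" and a: "a\<^sup>2 = F (p 0)" and b: "b\<^sup>2 = F (p 1)"
  obtains S where "sqrt_along F p S" "S 0 = a" "S 1 = (if sheet_change F a p b = 0 then b else - b)"
proof -
  obtain S where S: "sqrt_along F p S" "S 0 = a" using sqrt_along_exists[OF p a] .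
  then have "S 1 = b \<or> S 1 = - b"
    using b by (simp add: sqrt_along_def flip: power2_eq_iff)
  then show thesis
  proof
    assume "S 1 = b"
    moreover from this have "sheet_change F a p b = 0"
      by (intro sheet_change_eqI[OF p S b]) simp
    ultimately show thesis using that[OF S] by simp
  next
    assume "S 1 = - b"
    moreover from this have "sheet_change F a p b = 1"
      by (intro sheet_change_eqI[OF p S b]) simp
    ultimately show thesis using that[OF S] by simp
  qed
qed

lemma sheet_change_join:
  assumes p: "pathin X p" and q: "pathin X q" and pq: "p 1 = q 0"
    and a: "a\<^sup>2 = F (p 0)" and b: "b\<^sup>2 = F (p 1)" and c: "c\<^sup>2 = F (q 1)"
  shows "sheet_change F a (loop_join p q) c = sheet_change F a p b + sheet_change F b q c"
proof -
  let ?\<epsilon> = "sheet_change F a p b"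
  obtain S where S: "sqrt_along F p S" "S 0 = a" "S 1 = (if ?\<epsilon> = 0 then b else - b)"
    using sheet_change_lift[OF p a b] .
  obtain T where T: "sqrt_along F q T" "T 0 = b" "T 1 = (if sheet_change F b q c = 0 then c else - c)"
    using sheet_change_lift[OF q b[unfolded pq] c] .
  define T' where "T' = (\<lambda>t. if ?\<epsilon> = 0 then T t else - T t)"
  have T': "sqrt_along F q T'" "T' 0 = S 1" "T' 1 = (if ?\<epsilon> + sheet_change F b q c = 0 then c else - c)"
    using T S(3) unfolding T'_def
    by (cases "?\<epsilon> = 0"; simp add: sqrt_along_def continuous_on_minus)+
  have "pathin euclidean (loop_join S T')"
    using S(1) T'(1,2) by (intro pathin_loop_join) (simp_all add: pathin_def sqrt_along_def)
  then have "sqrt_along F (loop_join p q) (loop_join S T')"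
    using S(1) T'(1) by (simp add: sqrt_along_def pathin_def) (simp add: loop_join_def)
  then show ?thesis
    using sheet_change_eqI[OF pathin_loop_join[OF p q pq], of "loop_join S T'" a c "?\<epsilon> + sheet_change F b q c"]
      S(2) T'(3) c by simp
qed

lemma sheet_change_reverse:
  assumes p: "pathin X p" and a: "a\<^sup>2 = F (p 0)" and b: "b\<^sup>2 = F (p 1)"
  shows "sheet_change F b (reverse_path p) a = sheet_change F a p b"
proof -
  let ?\<epsilon> = "sheet_change F a p b"
  obtain S where S: "sqrt_along F p S" "S 0 = a" "S 1 = (if ?\<epsilon> = 0 then b else - b)"
    using sheet_change_lift[OF p a b] .
  define S' where "S' = (\<lambda>t. if ?\<epsilon> = 0 then S (1 - t) else - S (1 - t))"
  have "pathin euclidean (reverse_path S)"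
    using S(1) by (intro pathin_reverse_path) (simp add: pathin_def sqrt_along_def)
  then have "continuous_on {0..1} (\<lambda>t. S (1 - t))" by (simp add: pathin_def reverse_path_def)
  then have "sqrt_along F (reverse_path p) S'"
    using S(1) unfolding S'_def
    by (cases "?\<epsilon> = 0") (simp_all add: sqrt_along_def reverse_path_def continuous_on_minus)
  then show ?thesis
  proof (rule sheet_change_eqI[OF pathin_reverse_path[OF p]])
    show "S' 0 = b" "S' 1 = (if ?\<epsilon> = 0 then a else - a)"
      unfolding S'_def by (simp_all only: diff_self diff_zero S(2,3) minus_minus if_cancel split: if_split) simp
    show "a\<^sup>2 = F (reverse_path p 1)" using a by simp
  qed
qed

text \<open>
  A square root exists over the whole parameter square of a homotopy, since the square is
  contractible; along the two constant sides it does not move.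
\<close>

lemma sheet_change_homotopic:
  assumes pq: "path_homotopic X p q" and a: "a\<^sup>2 = F (p 0)" and b: "b\<^sup>2 = F (p 1)"
  shows "sheet_change F a q b = sheet_change F a p b"
proof -
  let ?I = "{0..1::real}"
  let ?\<epsilon> = "sheet_change F a p b"
  note pq_path = path_homotopic_pathin[OF pq]
  obtain h where h: "continuous_map (top_of_set (?I \<times> ?I)) X h"
    "\<And>t. t \<in> ?I \<Longrightarrow> h (0, t) = p t" "\<And>t. t \<in> ?I \<Longrightarrow> h (1, t) = q t"
    "\<And>s. s \<in> ?I \<Longrightarrow> h (s, 0) = p 0" "\<And>s. s \<in> ?I \<Longrightarrow> h (s, 1) = p 1"
    using pq unfolding path_homotopic_iff by blast
  have "continuous_map (top_of_set (?I \<times> ?I)) euclidean (F \<circ> h)"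
    using h(1) continuous_map by (rule continuous_map_compose)
  then have "continuous_on (?I \<times> ?I) (\<lambda>z. F (h z))" by (simp add: o_def)
  moreover have nz: "F (h z) \<noteq> 0" if "z \<in> ?I \<times> ?I" for z
    using h(1) that by (intro nonzero) (auto simp: continuous_map_def)
  moreover have "contractible (?I \<times> ?I)"
    by (intro convex_imp_contractible convex_Times) auto
  ultimately obtain R where R: "continuous_on (?I \<times> ?I) R" "\<And>z. z \<in> ?I \<times> ?I \<Longrightarrow> F (h z) = (R z)\<^sup>2"
    using continuous_sqrt_on_contractible[of "?I \<times> ?I" "\<lambda>z. F (h z)"] by blast
  have R0: "R z \<noteq> 0" if "z \<in> ?I \<times> ?I" for z
    using R(2)[OF that] nz[OF that] by auto
  define \<sigma> where "\<sigma> = (if R (0, 0) = a then 1 else - 1 :: complex)"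
  have "a\<^sup>2 = (R (0, 0))\<^sup>2" using R(2)[of "(0, 0)"] h(2)[of 0] a by simp
  then have \<sigma>: "\<sigma> * R (0, 0) = a" "\<sigma>\<^sup>2 = 1"
    unfolding power2_eq_iff \<sigma>_def by auto
  have const: "R (1, u) = R (0, u)" if u: "u = 0 \<or> u = 1" for u
  proof (rule continuous_sqrt_unique[of ?I "\<lambda>s. R (s, u)" "\<lambda>_. R (0, u)" 0])
    show "continuous_on ?I (\<lambda>s. R (s, u))"
      by (rule continuous_on_compose2[OF R(1)]) (use u in \<open>auto intro!: continuous_intros\<close>)
    show "(R (s, u))\<^sup>2 = (R (0, u))\<^sup>2" if "s \<in> ?I" for s
    proof -
      have "h (s, u) = h (0, u)" using that u h(4)[of s] h(5)[of s] h(4)[of 0] h(5)[of 0] by auto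
      then show ?thesis using that u R(2)[of "(s, u)"] R(2)[of "(0, u)"] by auto
    qed
  qed (use R0 u in auto)
  have slice: "continuous_on ?I (\<lambda>t. \<sigma> * R (s, t))" if "s \<in> ?I" for s
    by (intro continuous_intros continuous_on_compose2[OF R(1)]) (use that in auto)
  have S: "sqrt_along F p (\<lambda>t. \<sigma> * R (0, t))" "sqrt_along F q (\<lambda>t. \<sigma> * R (1, t))"
    unfolding sqrt_along_def power_mult_distrib \<sigma>(2)
    using slice[of 0] slice[of 1] by (simp_all add: R(2)[symmetric] h(2,3))
  obtain S' where S': "sqrt_along F p S'" "S' 0 = a" "S' 1 = (if ?\<epsilon> = 0 then b else - b)"
    using sheet_change_lift[OF pq_path(1) a b] .
  have "\<sigma> * R (0, 1) = S' 1"
    by (rule sqrt_along_unique[OF pq_path(1) S(1) S'(1)]) (simp only: \<sigma>(1) S'(2))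
  then have end1: "\<sigma> * R (1, 1) = (if ?\<epsilon> = 0 then b else - b)"
    unfolding S'(3) using const[of 1] by simp
  show ?thesis
  proof (rule sheet_change_eqI[OF pq_path(2) S(2) _ _ end1])
    show "\<sigma> * R (1, 0) = a" using const[of 0] \<sigma>(1) by simp
    show "b\<^sup>2 = F (q 1)" using b path_homotopic_ends(2)[OF pq] by simp
  qed
qed

end

section \<open>From the fundamental group to paths\<close>

lemma fundamental_group_carrier:
  "A \<in> carrier (fundamental_group X x) \<longleftrightarrow> (\<exists>p\<in>loops_at X x. A = loop_homotopy X x `` {p})"
  by (auto simp: fundamental_group_def quotient_def)

lemma loop_class_eq_iff:
  assumes "p \<in> loops_at X x" "q \<in> loops_at X x"
  shows "loop_homotopy X x `` {p} = loop_homotopy X x `` {q} \<longleftrightarrow> path_homotopic X p q"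
  using assms eq_equiv_class_iff[OF equiv_loop_homotopy[of X x], of p q]
  by (simp add: loop_homotopy_iff_path_homotopic loops_at_def)

lemma (in nonvanishing_map) sheet_change_character:
  assumes a: "a\<^sup>2 = F x"
  obtains \<phi> where "\<And>p. p \<in> loops_at X x \<Longrightarrow> \<phi> (loop_homotopy X x `` {p}) = sheet_change F a p a"
    and "\<And>A B. A \<in> carrier (fundamental_group X x) \<Longrightarrow> B \<in> carrier (fundamental_group X x)
      \<Longrightarrow> \<phi> (A \<otimes>\<^bsub>fundamental_group X x\<^esub> B) = \<phi> A + \<phi> B"
proof -
  let ?cl = "\<lambda>p. loop_homotopy X x `` {p}"
  define \<phi> where "\<phi> A = sheet_change F a (SOME p. p \<in> loops_at X x \<and> ?cl p = A) a" for A
  have \<phi>: "\<phi> (?cl p) = sheet_change F a p a" if p: "p \<in> loops_at X x" for p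
  proof -
    define q where "q = (SOME q. q \<in> loops_at X x \<and> ?cl q = ?cl p)"
    have q: "q \<in> loops_at X x \<and> ?cl q = ?cl p"
      unfolding q_def by (rule someI[of _ p]) (simp add: p)
    then have "path_homotopic X p q" using loop_class_eq_iff[OF p] by blast
    from sheet_change_homotopic[OF this, of a a] show ?thesis
      unfolding \<phi>_def q_def[symmetric] using a p by (simp add: loops_at_def)
  qed
  show thesis
  proof
    show "\<phi> (A \<otimes>\<^bsub>fundamental_group X x\<^esub> B) = \<phi> A + \<phi> B"
      if AB: "A \<in> carrier (fundamental_group X x)" "B \<in> carrier (fundamental_group X x)" for A B
    proof -
      obtain p q where pq: "p \<in> loops_at X x" "A = ?cl p" "q \<in> loops_at X x" "B = ?cl q"
        using AB unfolding fundamental_group_carrier by blast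
      have "sheet_change F a (loop_join p q) a = sheet_change F a p a + sheet_change F a q a"
        by (rule sheet_change_join) (use pq a in \<open>auto simp: loops_at_def\<close>)
      then show ?thesis
        using pq by (simp only: fundamental_group_mult \<phi> loop_join_in_loops)
    qed
  qed (rule \<phi>)
qed

text \<open>
  Paths between the points \<open>V i\<close> are turned into loops by connecting these points to \<open>x\<close>.  On
  such a loop the two characters differ from the sheet changes of the path by coboundaries,
  since the roots \<open>r\<close> and \<open>r'\<close> need not be the ones transported from \<open>x\<close>.  The cup product
  of a cocycle with a coboundary is a coboundary, and the last two terms in the definition of
  \<open>b\<close> absorb it.  The index type separates the points from the roots chosen over them.
\<close>

theorem free_fundamental_group_cochain:
  fixes X :: "'a topology" and V :: "'i \<Rightarrow> 'a" and r r' :: "'i \<Rightarrow> complex"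
  assumes free: "is_free_group (fundamental_group X x)"
    and F: "nonvanishing_map X F" and F': "nonvanishing_map X F'"
    and V: "\<And>i. i \<in> I \<Longrightarrow> path_component_of X x (V i)"
    and r: "\<And>i. i \<in> I \<Longrightarrow> (r i)\<^sup>2 = F (V i)" and r': "\<And>i. i \<in> I \<Longrightarrow> (r' i)\<^sup>2 = F' (V i)"
  obtains b :: "'i \<Rightarrow> (real \<Rightarrow> 'a) \<Rightarrow> 'i \<Rightarrow> bit"
  where "\<And>i j k p q. \<lbrakk>i \<in> I; j \<in> I; k \<in> I; pathin X p; pathin X q; p 0 = V i; p 1 = V j; q 0 = V j; q 1 = V k\<rbrakk>
      \<Longrightarrow> b i (loop_join p q) k
            = b i p j + b j q k + sheet_change F (r i) p (r j) * sheet_change F' (r' j) q (r' k)"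
    and "\<And>i j p q. \<lbrakk>i \<in> I; j \<in> I; path_homotopic X p q; p 0 = V i; p 1 = V j\<rbrakk>
      \<Longrightarrow> b i p j = b i q j"
proof -
  interpret F: nonvanishing_map X F by (rule F)
  interpret F': nonvanishing_map X F' by (rule F')
  let ?G = "fundamental_group X x"
  define cl where "cl p = loop_homotopy X x `` {p}" for p
  have "\<forall>i\<in>I. \<exists>g. pathin X g \<and> g 0 = x \<and> g 1 = V i"
    using V unfolding path_component_of_def by blast
  then obtain \<gamma> where \<gamma>: "\<And>i. i \<in> I \<Longrightarrow> pathin X (\<gamma> i)"
    "\<And>i. i \<in> I \<Longrightarrow> \<gamma> i 0 = x" "\<And>i. i \<in> I \<Longrightarrow> \<gamma> i 1 = V i"
    by metis
  define a where "a = csqrt (F x)"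
  define a' where "a' = csqrt (F' x)"
  have a: "a\<^sup>2 = F x" and a': "a'\<^sup>2 = F' x" by (simp_all add: a_def a'_def)
  obtain \<phi> where \<phi>: "\<And>p. p \<in> loops_at X x \<Longrightarrow> \<phi> (cl p) = sheet_change F a p a"
    and \<phi>_hom: "\<And>A B. A \<in> carrier ?G \<Longrightarrow> B \<in> carrier ?G \<Longrightarrow> \<phi> (A \<otimes>\<^bsub>?G\<^esub> B) = \<phi> A + \<phi> B"
    using F.sheet_change_character[OF a] unfolding cl_def by metis
  obtain \<psi> where \<psi>: "\<And>p. p \<in> loops_at X x \<Longrightarrow> \<psi> (cl p) = sheet_change F' a' p a'"
    and \<psi>_hom: "\<And>A B. A \<in> carrier ?G \<Longrightarrow> B \<in> carrier ?G \<Longrightarrow> \<psi> (A \<otimes>\<^bsub>?G\<^esub> B) = \<psi> A + \<psi> B"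
    using F'.sheet_change_character[OF a'] unfolding cl_def by metis
  obtain B where B: "\<And>A C. A \<in> carrier ?G \<Longrightarrow> C \<in> carrier ?G \<Longrightarrow> B (A \<otimes>\<^bsub>?G\<^esub> C) = B A + B C + \<phi> A * \<psi> C"
    using free_group_central_extension[OF free \<phi>_hom \<psi>_hom] by blast
  define g where "g i p j = loop_join (\<gamma> i) (loop_join p (reverse_path (\<gamma> j)))" for i p j
  define edge where "edge i p j \<longleftrightarrow> i \<in> I \<and> j \<in> I \<and> pathin X p \<and> p 0 = V i \<and> p 1 = V j" for i p j
  have tail: "pathin X (loop_join p (reverse_path (\<gamma> j)))" if "edge i p j" for i p j
    using that \<gamma> by (intro pathin_loop_join pathin_reverse_path) (auto simp: edge_def)
  have g_loop: "g i p j \<in> loops_at X x" if "edge i p j" for i p j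
    using that \<gamma> tail[OF that] pathin_loop_join[of X "\<gamma> i" "loop_join p (reverse_path (\<gamma> j))"]
    by (auto simp: edge_def g_def loops_at_def)
  have cl_carrier: "cl p \<in> carrier ?G" if "p \<in> loops_at X x" for p
    using that by (auto simp: cl_def fundamental_group_carrier)
  have edge_join: "edge i (loop_join p q) k" if "edge i p j" "edge j q k" for i p j q k
    using that pathin_loop_join[of X p q] by (auto simp: edge_def)
  have g_join: "cl (g i p j) \<otimes>\<^bsub>?G\<^esub> cl (g j q k) = cl (g i (loop_join p q) k)"
    if p: "edge i p j" and q: "edge j q k" for i p j q k
  proof -
    let ?k = "loop_join q (reverse_path (\<gamma> k))"
    let ?j = "reverse_path (\<gamma> j)"
    have ijk: "i \<in> I" "j \<in> I" "k \<in> I" using p q by (auto simp: edge_def)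
    note \<gamma>i = \<gamma>[OF ijk(1)] and \<gamma>j = \<gamma>[OF ijk(2)] and \<gamma>k = \<gamma>[OF ijk(3)]
    note pq = p[unfolded edge_def] q[unfolded edge_def]
    note paths = \<gamma>i(1) \<gamma>j(1) tail[OF p] tail[OF q] pathin_reverse_path[OF \<gamma>j(1)]
      pathin_reverse_path[OF \<gamma>k(1)]
    have jk: "pathin X (loop_join (\<gamma> j) ?k)"
      using paths pq \<gamma>j \<gamma>k by (intro pathin_loop_join) simp_all
    have "path_homotopic X (loop_join (g i p j) (g j q k))
            (loop_join (\<gamma> i) (loop_join (loop_join p ?j) (loop_join (\<gamma> j) ?k)))"
      unfolding g_def
      by (rule path_homotopic_assoc) (use paths jk pq \<gamma>i \<gamma>j \<gamma>k in simp_all)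
    also have "path_homotopic X \<dots> (loop_join (\<gamma> i) (loop_join p (loop_join ?j (loop_join (\<gamma> j) ?k))))"
      by (intro path_homotopic_join path_homotopic_assoc path_homotopic_refl)
        (use paths jk pq \<gamma>i \<gamma>j \<gamma>k in simp_all)
    also have "path_homotopic X \<dots> (loop_join (\<gamma> i) (loop_join p ?k))"
      by (intro path_homotopic_join path_homotopic_cancel path_homotopic_refl)
        (use paths jk pq \<gamma>i \<gamma>j \<gamma>k in simp_all)
    also have "path_homotopic X \<dots> (g i (loop_join p q) k)"
      unfolding g_def
      by (intro path_homotopic_join path_homotopic_sym[OF path_homotopic_assoc] path_homotopic_refl)
        (use paths jk pq \<gamma>i \<gamma>j \<gamma>k in simp_all)
    finally have "cl (loop_join (g i p j) (g j q k)) = cl (g i (loop_join p q) k)"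
      using loop_class_eq_iff[OF loop_join_in_loops[OF g_loop[OF p] g_loop[OF q]] g_loop[OF edge_join[OF p q]]]
      by (simp add: cl_def)
    then show ?thesis
      using fundamental_group_mult[OF g_loop[OF p] g_loop[OF q]] by (simp add: cl_def)
  qed
  define \<alpha> where "\<alpha> i = sheet_change F a (\<gamma> i) (r i)" for i
  define \<beta> where "\<beta> i = sheet_change F' a' (\<gamma> i) (r' i)" for i
  have \<phi>_g: "\<phi> (cl (g i p j)) = \<alpha> i + sheet_change F (r i) p (r j) + \<alpha> j" if p: "edge i p j" for i p j
  proof -
    have ij: "i \<in> I" "j \<in> I" and pp: "pathin X p" "p 0 = V i" "p 1 = V j" using p by (auto simp: edge_def)
    note \<gamma>i = \<gamma>[OF ij(1)] and \<gamma>j = \<gamma>[OF ij(2)]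
    have "sheet_change F (r j) (reverse_path (\<gamma> j)) a = \<alpha> j"
      unfolding \<alpha>_def by (rule F.sheet_change_reverse) (use \<gamma>j a r[OF ij(2)] in auto)
    moreover have "sheet_change F (r i) (loop_join p (reverse_path (\<gamma> j))) a
        = sheet_change F (r i) p (r j) + sheet_change F (r j) (reverse_path (\<gamma> j)) a"
      by (rule F.sheet_change_join) (use pp \<gamma>i \<gamma>j a r[OF ij(1)] r[OF ij(2)] pathin_reverse_path in auto)
    moreover have "sheet_change F a (g i p j) a
        = \<alpha> i + sheet_change F (r i) (loop_join p (reverse_path (\<gamma> j))) a"
      unfolding g_def \<alpha>_def
      by (rule F.sheet_change_join) (use pp \<gamma>i \<gamma>j a r[OF ij(1)] tail[OF p] in auto)
    ultimately show ?thesis using \<phi>[OF g_loop[OF p]] by (simp only: add.assoc)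
  qed
  have \<psi>_g: "\<psi> (cl (g i p j)) = \<beta> i + sheet_change F' (r' i) p (r' j) + \<beta> j" if p: "edge i p j" for i p j
  proof -
    have ij: "i \<in> I" "j \<in> I" and pp: "pathin X p" "p 0 = V i" "p 1 = V j" using p by (auto simp: edge_def)
    note \<gamma>i = \<gamma>[OF ij(1)] and \<gamma>j = \<gamma>[OF ij(2)]
    have "sheet_change F' (r' j) (reverse_path (\<gamma> j)) a' = \<beta> j"
      unfolding \<beta>_def by (rule F'.sheet_change_reverse) (use \<gamma>j a' r'[OF ij(2)] in auto)
    moreover have "sheet_change F' (r' i) (loop_join p (reverse_path (\<gamma> j))) a'
        = sheet_change F' (r' i) p (r' j) + sheet_change F' (r' j) (reverse_path (\<gamma> j)) a'"
      by (rule F'.sheet_change_join) (use pp \<gamma>i \<gamma>j a' r'[OF ij(1)] r'[OF ij(2)] pathin_reverse_path in auto)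
    moreover have "sheet_change F' a' (g i p j) a'
        = \<beta> i + sheet_change F' (r' i) (loop_join p (reverse_path (\<gamma> j))) a'"
      unfolding g_def \<beta>_def
      by (rule F'.sheet_change_join) (use pp \<gamma>i \<gamma>j a' r'[OF ij(1)] tail[OF p] in auto)
    ultimately show ?thesis using \<psi>[OF g_loop[OF p]] by (simp only: add.assoc)
  qed
  define b where "b i p j = B (cl (g i p j)) + \<alpha> i * \<psi> (cl (g i p j))
    + sheet_change F (r i) p (r j) * \<beta> j" for i p j
  show thesis
  proof
    fix i j k p q
    assume "i \<in> I" "j \<in> I" "k \<in> I" and pq: "pathin X p" "pathin X q" "p 0 = V i" "p 1 = V j" "q 0 = V j" "q 1 = V k"
    then have ijk: "i \<in> I" "j \<in> I" "k \<in> I" and p: "edge i p j" and q: "edge j q k"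
      by (auto simp: edge_def)
    let ?f = "sheet_change F (r i) p (r j)" and ?h = "sheet_change F (r j) q (r k)"
    let ?k = "sheet_change F' (r' j) q (r' k)"
    have 1: "sheet_change F (r i) (loop_join p q) (r k) = ?f + ?h"
      by (rule F.sheet_change_join) (use pq r ijk in auto)
    have 2: "B (cl (g i (loop_join p q) k))
        = B (cl (g i p j)) + B (cl (g j q k)) + (\<alpha> i + ?f + \<alpha> j) * (\<beta> j + ?k + \<beta> k)"
      using B[OF cl_carrier[OF g_loop[OF p]] cl_carrier[OF g_loop[OF q]]]
      by (simp only: g_join[OF p q] \<phi>_g[OF p] \<psi>_g[OF q])
    have 3: "\<psi> (cl (g i (loop_join p q) k)) = \<psi> (cl (g i p j)) + \<psi> (cl (g j q k))"
      using \<psi>_hom[OF cl_carrier[OF g_loop[OF p]] cl_carrier[OF g_loop[OF q]]]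
      by (simp only: g_join[OF p q])
    have arith: "B1 + B2 + (x + f + y) * (s + t + u) + x * (P + (s + t + u)) + (f + h) * u
        = (B1 + x * P + f * s) + (B2 + y * (s + t + u) + h * u) + f * t"
      for B1 B2 x f y s t u P h :: bit
      by (simp only: distrib_left distrib_right ac_simps bit_double bit_double_left add_0_right)
    show "b i (loop_join p q) k = b i p j + b j q k + ?f * ?k"
      unfolding b_def 1 2 3 \<psi>_g[OF q] by (rule arith)
  next
    fix i j p q
    assume ij: "i \<in> I" "j \<in> I" and pq: "path_homotopic X p q" and ends: "p 0 = V i" "p 1 = V j"
    note q_ends = path_homotopic_ends[OF pq] and paths = path_homotopic_pathin[OF pq]
    have p: "edge i p j" and q: "edge i q j" using ij ends q_ends paths by (auto simp: edge_def)
    have "path_homotopic X (g i p j) (g i q j)"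
      unfolding g_def
      by (intro path_homotopic_join path_homotopic_refl pq)
        (use \<gamma>[OF ij(1)] \<gamma>[OF ij(2)] ends pathin_reverse_path in auto)
    then have "cl (g i p j) = cl (g i q j)"
      using loop_class_eq_iff[OF g_loop[OF p] g_loop[OF q]] by (simp add: cl_def)
    moreover have "sheet_change F (r i) q (r j) = sheet_change F (r i) p (r j)"
      by (rule F.sheet_change_homotopic[OF pq]) (use ends r ij in auto)
    ultimately show "b i p j = b i q j" by (simp add: b_def)
  qed
qed

section \<open>Configurations of three points\<close>

definition triple :: "'a \<Rightarrow> 'a \<Rightarrow> 'a \<Rightarrow> nat \<Rightarrow> 'a" where
  "triple a b c = (\<lambda>_. undefined)(0 := a, 1 := b, 2 := c)"

definition conf3 :: "'a \<Rightarrow> 'a \<Rightarrow> 'a \<Rightarrow> (nat \<Rightarrow> 'a) set" where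
  "conf3 a b c = perm_orbit 3 (triple a b c)"

lemma triple_simps [simp]: "triple a b c 0 = a" "triple a b c 1 = b" "triple a b c (Suc 0) = b" "triple a b c 2 = c"
  by (simp_all add: triple_def)

lemma lessThan_3: "{..<3::nat} = {0, 1, 2}" by auto

lemma triple_extensional: "triple a b c \<in> extensional {..<3}"
  by (auto simp: triple_def extensional_def)

lemma extensional_eq_triple: "x \<in> extensional {..<3} \<Longrightarrow> x = triple (x 0) (x 1) (x 2)"
  by (force simp: triple_def extensional_def fun_eq_iff)

lemma perm_orbit_compose:
  assumes "\<sigma> permutes {..<n}"
  shows "perm_orbit n (x \<circ> \<sigma>) = perm_orbit n x"
proof
  show "perm_orbit n (x \<circ> \<sigma>) \<subseteq> perm_orbit n x"
    using permutes_compose[OF _ assms] by (fastforce simp: perm_orbit_def o_assoc[symmetric])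
  show "perm_orbit n x \<subseteq> perm_orbit n (x \<circ> \<sigma>)"
  proof
    fix y assume "y \<in> perm_orbit n x"
    then obtain \<tau> where \<tau>: "\<tau> permutes {..<n}" "y = x \<circ> \<tau>" by (auto simp: perm_orbit_def)
    then have "y = (x \<circ> \<sigma>) \<circ> (inv_into UNIV \<sigma> \<circ> \<tau>)"
      using permutes_inv_o(1)[OF assms] by (metis comp_assoc comp_id)
    moreover have "(inv_into UNIV \<sigma> \<circ> \<tau>) permutes {..<n}"
      by (intro permutes_compose \<tau>(1) permutes_inv assms)
    ultimately show "y \<in> perm_orbit n (x \<circ> \<sigma>)" by (auto simp: perm_orbit_def)
  qed
qed

lemma conf3_swap: "conf3 a b c = conf3 b a c" "conf3 a b c = conf3 a c b"
proof -
  have "triple b a c = triple a b c \<circ> Transposition.transpose 0 1" for a b c :: 'a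
    by (auto simp: fun_eq_iff triple_def Transposition.transpose_def)
  moreover have "triple a c b = triple a b c \<circ> Transposition.transpose 1 2" for a b c :: 'a
    by (auto simp: fun_eq_iff triple_def Transposition.transpose_def)
  moreover have "Transposition.transpose 0 1 permutes {..<3::nat}"
    "Transposition.transpose 1 2 permutes {..<3::nat}"
    by (intro permutes_swap_id; simp)+
  ultimately show "conf3 a b c = conf3 b a c" "conf3 a b c = conf3 a c b"
    unfolding conf3_def by (metis perm_orbit_compose)+
qed

lemma topspace_ordered_conf_3:
  "x \<in> topspace (ordered_conf 3 X) \<longleftrightarrow> x \<in> extensional {..<3} \<and>
     x 0 \<in> topspace X \<and> x 1 \<in> topspace X \<and> x 2 \<in> topspace X \<and> distinct [x 0, x 1, x 2]"
  unfolding ordered_conf_def by (auto simp: lessThan_3 PiE_iff)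

lemma conf3_in_topspace:
  assumes "a \<in> topspace X" "b \<in> topspace X" "c \<in> topspace X" "distinct [a, b, c]"
  shows "conf3 a b c \<in> topspace (Conf 3 X)"
  using assms triple_extensional[of a b c]
  by (auto simp: Conf_def conf3_def topspace_ordered_conf_3 intro!: imageI)

lemma topspace_Conf_3E:
  assumes "A \<in> topspace (Conf 3 X)"
  obtains a b c where "a \<in> topspace X" "b \<in> topspace X" "c \<in> topspace X" "distinct [a, b, c]"
    "A = conf3 a b c"
proof -
  obtain x where x: "x \<in> topspace (ordered_conf 3 X)" "A = perm_orbit 3 x"
    using assms by (auto simp: Conf_def)
  moreover have "A = conf3 (x 0) (x 1) (x 2)"
    using x extensional_eq_triple[of x] unfolding conf3_def topspace_ordered_conf_3 by metis
  ultimately show thesis using that unfolding topspace_ordered_conf_3 by blast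
qed

lemma continuous_map_conf3:
  assumes "continuous_map Z X a" "continuous_map Z X b" "continuous_map Z X c"
    and "\<And>z. z \<in> topspace Z \<Longrightarrow> distinct [a z, b z, c z]"
  shows "continuous_map Z (Conf 3 X) (\<lambda>z. conf3 (a z) (b z) (c z))"
proof -
  have "continuous_map Z (product_topology (\<lambda>_. X) {..<3}) (\<lambda>z. triple (a z) (b z) (c z))"
    unfolding continuous_map_componentwise
    using triple_extensional assms(1-3) by (auto simp: lessThan_3)
  then have "continuous_map Z (ordered_conf 3 X) (\<lambda>z. triple (a z) (b z) (c z))"
    unfolding ordered_conf_def using assms(4)
    by (auto simp: continuous_map_in_subtopology lessThan_3)
  from continuous_map_compose[OF this quotient_imp_continuous_map[OF quotient_map_quotient_topology]]
  show ?thesis by (simp add: Conf_def conf3_def o_def)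
qed

lemma symmetric_function_permute:
  assumes sym: "\<And>a b c. g a b c = g b a c" "\<And>a b c. g a b c = g a c b"
    and \<sigma>: "\<sigma> permutes {..<3::nat}"
  shows "g (x (\<sigma> 0)) (x (\<sigma> 1)) (x (\<sigma> 2)) = g (x 0) (x 1) (x 2)"
proof -
  have in3: "\<sigma> 0 \<in> {0, 1, 2}" "\<sigma> 1 \<in> {0, 1, 2}" "\<sigma> 2 \<in> {0, 1, 2}"
    using permutes_in_image[OF \<sigma>] unfolding lessThan_3 by blast+
  have inj: "\<sigma> 0 \<noteq> \<sigma> 1" "\<sigma> 0 \<noteq> \<sigma> 2" "\<sigma> 1 \<noteq> \<sigma> 2"
    using permutes_inj[OF \<sigma>] by (simp_all add: inj_eq)
  have "g (x 1) (x 0) (x 2) = g (x 0) (x 1) (x 2)" "g (x 0) (x 2) (x 1) = g (x 0) (x 1) (x 2)"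
    by (rule sym)+
  moreover from this have "g (x 1) (x 2) (x 0) = g (x 0) (x 1) (x 2)"
    "g (x 2) (x 0) (x 1) = g (x 0) (x 1) (x 2)"
    using sym(2)[of "x 1" "x 0" "x 2"] sym(1)[of "x 0" "x 2" "x 1"] by simp_all
  moreover from this have "g (x 2) (x 1) (x 0) = g (x 0) (x 1) (x 2)"
    using sym(2)[of "x 2" "x 0" "x 1"] by simp
  moreover note in3 inj
  ultimately show ?thesis by (elim insertE emptyE) simp_all
qed

text \<open>
  A function on the quotient by all permutations is a function invariant under the two
  adjacent transpositions.
\<close>

lemma symmetric_map_on_Conf:
  fixes g :: "'a \<Rightarrow> 'a \<Rightarrow> 'a \<Rightarrow> complex"
  assumes sym: "\<And>a b c. g a b c = g b a c" "\<And>a b c. g a b c = g a c b"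
    and cont: "continuous_map (ordered_conf 3 X) euclidean (\<lambda>x. g (x 0) (x 1) (x 2))"
    and nz: "\<And>a b c. \<lbrakk>a \<in> topspace X; b \<in> topspace X; c \<in> topspace X; distinct [a, b, c]\<rbrakk> \<Longrightarrow> g a b c \<noteq> 0"
  obtains F where "nonvanishing_map (Conf 3 X) F"
    and "\<And>a b c. \<lbrakk>a \<in> topspace X; b \<in> topspace X; c \<in> topspace X; distinct [a, b, c]\<rbrakk>
          \<Longrightarrow> F (conf3 a b c) = g a b c"
proof -
  have orbit: "g (x 0) (x 1) (x 2) = g (y 0) (y 1) (y 2)" if "perm_orbit 3 x = perm_orbit 3 y" for x y
  proof -
    have "x \<in> perm_orbit 3 x"
      unfolding perm_orbit_def by (rule CollectI, rule exI[of _ id]) (simp add: permutes_id)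
    then have "x \<in> perm_orbit 3 y" by (simp only: that)
    then obtain \<sigma> where "\<sigma> permutes {..<3}" "x = y \<circ> \<sigma>"
      unfolding perm_orbit_def mem_Collect_eq by (elim exE conjE) (rule that)
    then show ?thesis using symmetric_function_permute[of g \<sigma> y, OF sym] by simp
  qed
  have quot: "quotient_map (ordered_conf 3 X) (Conf 3 X) (perm_orbit 3)"
    unfolding Conf_def by (rule quotient_map_quotient_topology)
  show thesis
  proof (rule quotient_map_lift_exists[OF quot cont])
    show "g (x 0) (x 1) (x 2) = g (y 0) (y 1) (y 2)" if "perm_orbit 3 x = perm_orbit 3 y" for x y
      using that by (rule orbit)
  next
    fix F assume F: "continuous_map (Conf 3 X) euclidean F"
      "\<And>x. x \<in> topspace (ordered_conf 3 X) \<Longrightarrow> F (perm_orbit 3 x) = g (x 0) (x 1) (x 2)"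
    have F3: "F (conf3 a b c) = g a b c"
      if "a \<in> topspace X" "b \<in> topspace X" "c \<in> topspace X" "distinct [a, b, c]" for a b c
      using F(2)[of "triple a b c"] that triple_extensional[of a b c]
      by (simp add: conf3_def topspace_ordered_conf_3)
    moreover have "nonvanishing_map (Conf 3 X) F"
    proof
      fix A assume "A \<in> topspace (Conf 3 X)"
      then obtain a b c where "a \<in> topspace X" "b \<in> topspace X" "c \<in> topspace X" "distinct [a, b, c]"
        "A = conf3 a b c" by (rule topspace_Conf_3E)
      then show "F A \<noteq> 0" using nz F3 by simp
    qed (rule F(1))
    ultimately show thesis by (intro that[of F])
  qed
qed

lemma continuous_map_ordered_conf_component:
  assumes "continuous_map X Y f" "i < n"
  shows "continuous_map (ordered_conf n X) Y (\<lambda>x. f (x i))"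
proof -
  have "continuous_map (ordered_conf n X) X (\<lambda>x. x i)"
    unfolding ordered_conf_def using assms(2)
    by (intro continuous_map_from_subtopology continuous_map_product_projection) simp
  from continuous_map_compose[OF this assms(1)] show ?thesis by (simp add: o_def)
qed

section \<open>Maps into and out of graphs\<close>

lemma continuous_map_edge:
  assumes "e \<in> arcs G"
  shows "continuous_map (top_of_set {0..1}) (graph_space G) (\<lambda>t. graph_glue G (Inr e, t))"
proof -
  have "continuous_map (top_of_set {0..1}) (graph_pieces G) (\<lambda>t. (Inr e, t))"
    using continuous_map_component_injection[of "Inr e" "verts G <+> arcs G"
        "\<lambda>i. case i of Inl v \<Rightarrow> top_of_set {0} | Inr e \<Rightarrow> top_of_set {0..1}"] assms
    by (simp add: graph_pieces_def InrI)
  from continuous_map_compose[OF this quotient_imp_continuous_map[OF quotient_map_quotient_topology]]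
  show ?thesis by (simp add: graph_space_def o_def)
qed

lemma continuous_map_from_graph_space:
  assumes v: "\<And>v. v \<in> verts G \<Longrightarrow> f (Vertex v) \<in> topspace Y"
    and e: "\<And>e. e \<in> arcs G \<Longrightarrow> continuous_map (top_of_set {0..1}) Y (\<lambda>t. f (graph_glue G (Inr e, t)))"
  shows "continuous_map (graph_space G) Y f"
proof -
  let ?T = "\<lambda>i. case i of Inl v \<Rightarrow> top_of_set {0} | Inr e \<Rightarrow> top_of_set {0..1}"
  have piece: "continuous_map (?T i) Y (\<lambda>t. f (graph_glue G (i, t)))" if "i \<in> verts G <+> arcs G" for i
  proof (cases i)
    case (Inl w)
    then have "w \<in> verts G" using that by auto
    then have "continuous_map (?T i) Y (\<lambda>_. f (Vertex w))" using v by simp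
    then show ?thesis by (simp add: Inl graph_glue_def)
  qed (use e that in auto)
  have open_iff: "openin (graph_pieces G) W \<longleftrightarrow>
      W \<subseteq> topspace (graph_pieces G) \<and> (\<forall>i \<in> verts G <+> arcs G. openin (?T i) {t. (i, t) \<in> W})" for W
    unfolding graph_pieces_def openin_sum_topology topspace_sum_topology ..
  have "continuous_map (graph_pieces G) Y (f \<circ> graph_glue G)"
    unfolding continuous_map_def
  proof (intro conjI allI impI)
    show "f \<circ> graph_glue G \<in> topspace (graph_pieces G) \<rightarrow> topspace Y"
    proof
      fix z assume z: "z \<in> topspace (graph_pieces G)"
      obtain i t where it: "z = (i, t)" by (cases z)
      then have "i \<in> verts G <+> arcs G" "t \<in> topspace (?T i)"
        using z by (simp_all add: graph_pieces_def)
      then show "(f \<circ> graph_glue G) z \<in> topspace Y"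
        using continuous_map_image_subset_topspace[OF piece] by (auto simp: it)
    qed
    fix U assume U: "openin Y U"
    have "openin (?T i) {t. (i, t) \<in> {x \<in> topspace (graph_pieces G). (f \<circ> graph_glue G) x \<in> U}}"
      if i: "i \<in> verts G <+> arcs G" for i
    proof -
      have "{t. (i, t) \<in> {x \<in> topspace (graph_pieces G). (f \<circ> graph_glue G) x \<in> U}}
          = {t \<in> topspace (?T i). f (graph_glue G (i, t)) \<in> U}"
        using i by (simp add: graph_pieces_def)
      then show ?thesis using openin_continuous_map_preimage[OF piece[OF i] U] by simp
    qed
    then show "openin (graph_pieces G) {x \<in> topspace (graph_pieces G). (f \<circ> graph_glue G) x \<in> U}"
      unfolding open_iff by blast
  qed
  then show ?thesis
    unfolding graph_space_def
    by (rule continuous_compose_quotient_map[OF quotient_map_quotient_topology])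
qed

lemma (in wf_digraph) topspace_graph_space:
  "topspace (graph_space G) = Vertex ` verts G \<union> {Inner e t | e t. e \<in> arcs G \<and> 0 < t \<and> t < 1}"
proof (rule subset_antisym; rule subsetI)
  fix x assume "x \<in> topspace (graph_space G)"
  then obtain z where z: "z \<in> topspace (graph_pieces G)" "x = graph_glue G z"
    by (auto simp: graph_space_def)
  obtain i t where it: "z = (i, t)" by (cases z)
  show "x \<in> Vertex ` verts G \<union> {Inner e t | e t. e \<in> arcs G \<and> 0 < t \<and> t < 1}"
  proof (cases i)
    case (Inl v)
    then show ?thesis using z by (auto simp: it graph_pieces_def graph_glue_def)
  next
    case (Inr e)
    then have "e \<in> arcs G" "0 \<le> t" "t \<le> 1" using z by (auto simp: it graph_pieces_def)
    then show ?thesis using z Inr by (auto simp: it graph_glue_def)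
  qed
next
  fix x assume "x \<in> Vertex ` verts G \<union> {Inner e t | e t. e \<in> arcs G \<and> 0 < t \<and> t < 1}"
  then consider v where "x = Vertex v" "v \<in> verts G"
    | e t where "x = Inner e t" "e \<in> arcs G" "0 < t" "t < 1" by blast
  then show "x \<in> topspace (graph_space G)"
  proof cases
    case 1
    then have "(Inl v, 0) \<in> topspace (graph_pieces G)" "x = graph_glue G (Inl v, 0)"
      by (auto simp: graph_pieces_def graph_glue_def)
    then show ?thesis unfolding graph_space_def topspace_quotient_topology by (intro image_eqI)
  next
    case 2
    then have "(Inr e, t) \<in> topspace (graph_pieces G)" "x = graph_glue G (Inr e, t)"
      by (auto simp: graph_pieces_def graph_glue_def)
    then show ?thesis unfolding graph_space_def topspace_quotient_topology by (intro image_eqI)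
  qed
qed

section \<open>Connectedness of the configuration space\<close>

lemma conf3_cong_set:
  assumes "{a, b, c} = {a', b', c'}" "distinct [a, b, c]" "distinct [a', b', c']"
  shows "conf3 a b c = conf3 a' b' c'"
proof -
  have "a' \<in> {a, b, c}" "b' \<in> {a, b, c}" "c' \<in> {a, b, c}" using assms(1) by auto
  then show ?thesis
    using assms(2,3) by (elim insertE emptyE) (simp_all add: conf3_swap)
qed

abbreviation edge_point :: "('v, 'e) pre_digraph \<Rightarrow> 'e \<Rightarrow> real \<Rightarrow> ('v, 'e) graph_point" where
  "edge_point G e t \<equiv> graph_glue G (Inr e, t)"

lemma path_component_moveI:
  assumes "pathin X a" "pathin X b" "pathin X c"
    and "\<And>t. t \<in> {0..1} \<Longrightarrow> distinct [a t, b t, c t]"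
  shows "path_component_of (Conf 3 X) (conf3 (a 0) (b 0) (c 0)) (conf3 (a 1) (b 1) (c 1))"
proof -
  have "pathin (Conf 3 X) (\<lambda>t. conf3 (a t) (b t) (c t))"
    using assms unfolding pathin_def by (intro continuous_map_conf3) auto
  then show ?thesis unfolding path_component_of_def by blast
qed

lemma pathin_along_edge:
  assumes "e \<in> arcs G" "a \<in> {0..1}" "b \<in> {0..1}"
  shows "pathin (graph_space G) (\<lambda>t. edge_point G e ((1 - t) * a + t * b))"
proof -
  have "continuous_on {0..1} (\<lambda>t. (1 - t) * a + t * b)" by (intro continuous_intros)
  moreover have "(1 - t) * a + t * b \<in> {0..1}" if "t \<in> {0..1}" for t
    using convexD[OF convex_real_interval(5) assms(2,3), of "1 - t" t] that by simp
  ultimately have "continuous_map (top_of_set {0..1}) (top_of_set {0..1}) (\<lambda>t. (1 - t) * a + t * b)"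
    by auto
  from continuous_map_compose[OF this continuous_map_edge[OF assms(1)]]
  show ?thesis by (simp add: pathin_def o_def)
qed

lemma path_component_move_along_edge:
  assumes e: "e \<in> arcs G" and a: "a \<in> {0..1}" and b: "b \<in> {0..1}"
    and yz: "y \<in> topspace (graph_space G)" "z \<in> topspace (graph_space G)" "y \<noteq> z"
    and avoid: "\<And>t. t \<in> closed_segment a b \<Longrightarrow> edge_point G e t \<notin> {y, z}"
  shows "path_component_of (Conf 3 (graph_space G)) (conf3 (edge_point G e a) y z) (conf3 (edge_point G e b) y z)"
proof -
  have seg: "(1 - t) * a + t * b \<in> closed_segment a b" if "t \<in> {0..1}" for t
    using that by (auto simp: in_segment intro!: exI[of _ t])
  show ?thesis
    using path_component_moveI[OF pathin_along_edge[OF e a b], of "\<lambda>_. y" "\<lambda>_. z"] yz avoid[OF seg]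
    by (auto simp: pathin_const)
qed

lemma finite_lower_bound:
  fixes T :: "real set"
  assumes "finite T"
  obtains \<epsilon> where "0 < \<epsilon>" "\<epsilon> < 1" "\<And>t. t \<in> T \<Longrightarrow> 0 < t \<Longrightarrow> \<epsilon> < t"
proof -
  have "\<exists>\<epsilon>>0. \<epsilon> < 1 \<and> (\<forall>t\<in>T. 0 < t \<longrightarrow> \<epsilon> < t)"
    using assms
  proof (induction T)
    case empty
    show ?case by (intro exI[of _ "1/2"]) simp
  next
    case (insert t T)
    then obtain \<epsilon> where \<epsilon>: "0 < \<epsilon>" "\<epsilon> < 1" "\<forall>t\<in>T. 0 < t \<longrightarrow> \<epsilon> < t" by blast
    show ?case
      by (rule exI[of _ "if 0 < t then min \<epsilon> (t / 2) else \<epsilon>"]) (use \<epsilon> in \<open>auto simp: min_less_iff_disj\<close>)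
  qed
  then show thesis using that by blast
qed

locale pulsar_graph =
  fixes m n1 n2 :: nat
  assumes m: "m > 0"
begin

abbreviation "P \<equiv> pulsar m n1 n2"
abbreviation "\<Gamma> \<equiv> graph_space P"

lemma topspace_\<Gamma>:
  "topspace \<Gamma> = Vertex ` verts P \<union> {Inner e t | e t. e \<in> arcs P \<and> 0 < t \<and> t < 1}"
proof -
  interpret fin_digraph P by (rule fin_digraph_pulsar)
  show ?thesis by (rule topspace_graph_space)
qed

lemma edge_point_simps:
  "edge_point P (Arc i) t = (if t = 0 then Vertex Hub1 else if t = 1 then Vertex Hub2 else Inner (Arc i) t)"
  "edge_point P (Ray1 j) t = (if t = 0 then Vertex Hub1 else if t = 1 then Vertex (Tip1 j) else Inner (Ray1 j) t)"
  "edge_point P (Ray2 j) t = (if t = 0 then Vertex Hub2 else if t = 1 then Vertex (Tip2 j) else Inner (Ray2 j) t)"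
  by (simp_all add: graph_glue_def pulsar_def)

lemma Arc_in_arcs: "i < m \<Longrightarrow> Arc i \<in> arcs P"
  by (simp add: pulsar_def)

definition arc0 :: "(pulsar_vertex, pulsar_edge) graph_point set" where
  "arc0 = {Inner (Arc 0) t | t. 0 < t \<and> t < 1}"

lemma arc0_subset: "arc0 \<subseteq> topspace \<Gamma>"
  using m by (auto simp: arc0_def topspace_\<Gamma> Arc_in_arcs)

text \<open>
  Only finitely many positions are occupied, so an initial piece of the arc is free.
\<close>

lemma hub_to_arc0:
  assumes x: "x = Vertex Hub1 \<or> x = Vertex Hub2"
    and yz: "y \<in> topspace \<Gamma>" "z \<in> topspace \<Gamma>" "distinct [x, y, z]"
  obtains x' where "x' \<in> arc0" "x' \<notin> {y, z}"
    "path_component_of (Conf 3 \<Gamma>) (conf3 x y z) (conf3 x' y z)"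
proof -
  define s where "s t = (if x = Vertex Hub1 then t else 1 - t)" for t :: real
  have "inj (\<lambda>t. Inner (Arc 0) (s t) :: (pulsar_vertex, pulsar_edge) graph_point)"
    by (auto simp: inj_def s_def)
  then have "finite ((\<lambda>t. Inner (Arc 0) (s t)) -` {y, z})" by (intro finite_vimageI) simp
  then obtain \<epsilon> where \<epsilon>: "0 < \<epsilon>" "\<epsilon> < 1" and avoid: "\<And>t. Inner (Arc 0) (s t) \<in> {y, z} \<Longrightarrow> 0 < t \<Longrightarrow> \<epsilon> < t"
    by (rule finite_lower_bound) blast
  have s0: "edge_point P (Arc 0) (s 0) = x" using x by (auto simp: s_def edge_point_simps)
  have s\<epsilon>: "edge_point P (Arc 0) (s \<epsilon>) = Inner (Arc 0) (s \<epsilon>)"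
    using \<epsilon> by (auto simp: s_def edge_point_simps)
  have "edge_point P (Arc 0) t \<notin> {y, z}" if seg: "t \<in> closed_segment (s 0) (s \<epsilon>)" for t
  proof -
    define u where "u = s t"
    have u: "t = s u" "0 \<le> u" "u \<le> \<epsilon>"
      using seg \<epsilon> by (auto simp: u_def s_def closed_segment_eq_real_ivl split: if_splits)
    show ?thesis
    proof (cases "u = 0")
      case True
      then show ?thesis using s0 yz u by auto
    next
      case False
      then have "edge_point P (Arc 0) t = Inner (Arc 0) (s u)"
        using u \<epsilon> by (auto simp: s_def edge_point_simps)
      then show ?thesis using avoid[of u] False u by auto
    qed
  qed
  then have "path_component_of (Conf 3 \<Gamma>) (conf3 (edge_point P (Arc 0) (s 0)) y z)
      (conf3 (edge_point P (Arc 0) (s \<epsilon>)) y z)"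
    using yz m \<epsilon> by (intro path_component_move_along_edge Arc_in_arcs) (auto simp: s_def)
  moreover have "Inner (Arc 0) (s \<epsilon>) \<in> arc0" using \<epsilon> by (auto simp: arc0_def s_def)
  moreover have "Inner (Arc 0) (s \<epsilon>) \<notin> {y, z}" using avoid[of \<epsilon>] \<epsilon> by auto
  ultimately show thesis using that unfolding s0 s\<epsilon> by blast
qed

lemma outside_arc0:
  assumes "x \<in> topspace \<Gamma>" "x \<notin> arc0"
  obtains "x = Vertex Hub1 \<or> x = Vertex Hub2"
  | e t where "e \<in> arcs P" "e \<noteq> Arc 0" "0 < t" "t \<le> 1" "x = edge_point P e t"
proof -
  have "x = Vertex Hub1 \<or> x = Vertex Hub2 \<or>
      (\<exists>e t. e \<in> arcs P \<and> e \<noteq> Arc 0 \<and> 0 < t \<and> t \<le> 1 \<and> x = edge_point P e t)"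
  proof (cases x)
    case (Vertex v)
    show ?thesis
    proof (cases v)
      case (Tip1 j)
      then have "Ray1 j \<in> arcs P" using assms(1) unfolding Vertex topspace_\<Gamma> by (auto simp: pulsar_def)
      then show ?thesis using Vertex Tip1 by (intro disjI2 exI[of _ "Ray1 j"] exI[of _ 1]) (simp add: edge_point_simps)
    next
      case (Tip2 j)
      then have "Ray2 j \<in> arcs P" using assms(1) unfolding Vertex topspace_\<Gamma> by (auto simp: pulsar_def)
      then show ?thesis using Vertex Tip2 by (intro disjI2 exI[of _ "Ray2 j"] exI[of _ 1]) (simp add: edge_point_simps)
    qed (use Vertex in auto)
  next
    case (Inner e t)
    then have "e \<in> arcs P" "0 < t" "t < 1" using assms(1) by (auto simp: topspace_\<Gamma>)
    moreover have "e \<noteq> Arc 0" using assms(2) Inner calculation by (auto simp: arc0_def)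
    moreover have "x = edge_point P e t" using Inner calculation by (cases e) (auto simp: edge_point_simps)
    ultimately show ?thesis by (intro disjI2 exI[of _ e] exI[of _ t]) simp
  qed
  then show thesis using that by blast
qed

lemma edge_point_0: "edge_point P e 0 = Vertex Hub1 \<or> edge_point P e 0 = Vertex Hub2"
  by (cases e) (simp_all add: edge_point_simps)

lemma edge_point_inj:
  assumes "edge_point P e s = edge_point P e t" "s \<in> {0..1}" "t \<in> {0..1}"
  shows "s = t"
  using assms by (cases e) (auto simp: edge_point_simps split: if_splits)

lemma finite_edge_param:
  assumes "finite A"
  shows "finite {t \<in> {0..1}. edge_point P e t \<in> A}"
proof -
  have "inj_on (edge_point P e) {0..1}" by (rule inj_onI) (rule edge_point_inj)
  then have "finite (edge_point P e -` A \<inter> {0..1})" using assms by (rule finite_vimage_IntI[rotated])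
  moreover have "edge_point P e -` A \<inter> {0..1} = {t \<in> {0..1}. edge_point P e t \<in> A}" by auto
  ultimately show ?thesis by simp
qed

text \<open>
  A particle outside the open arc \<open>0\<close> can be brought there once the way is clear.  A particle at a hub
  can enter directly.  If both hubs are free, the particle closest to the tail of its edge
  reaches this hub without meeting another one; every edge has a hub as its tail.
\<close>

lemma move_one_to_arc0:
  assumes top: "{x, y, z} \<subseteq> topspace \<Gamma>" and d: "distinct [x, y, z]" and x: "x \<notin> arc0"
  obtains p q r p' where "{p, q, r} = {x, y, z}" "distinct [p, q, r]" "p \<notin> arc0"
    "p' \<in> arc0" "p' \<notin> {q, r}" "path_component_of (Conf 3 \<Gamma>) (conf3 x y z) (conf3 p' q r)"
proof (cases "\<exists>p\<in>{x, y, z}. p = Vertex Hub1 \<or> p = Vertex Hub2")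
  case True
  then obtain p where p: "p \<in> {x, y, z}" "p = Vertex Hub1 \<or> p = Vertex Hub2" by blast
  obtain q r where qr: "{p, q, r} = {x, y, z}" "distinct [p, q, r]"
  proof -
    have "{x, z, y} = {x, y, z}" "{y, x, z} = {x, y, z}" "{z, x, y} = {x, y, z}" by auto
    then show thesis using p(1) d that[of y z] that[of x z] that[of x y] by auto
  qed
  have "q \<in> topspace \<Gamma>" "r \<in> topspace \<Gamma>" using qr(1) top by auto
  then obtain p' where p': "p' \<in> arc0" "p' \<notin> {q, r}"
    "path_component_of (Conf 3 \<Gamma>) (conf3 p q r) (conf3 p' q r)"
    using hub_to_arc0[OF p(2) _ _ qr(2)] by blast
  have "p \<notin> arc0" using p(2) by (auto simp: arc0_def)
  then show thesis using that[OF qr _ p'(1,2)] p'(3) conf3_cong_set[OF qr d] by simp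
next
  case False
  then obtain e t where e: "e \<in> arcs P" "e \<noteq> Arc 0" and t: "0 < t" "t \<le> 1" "x = edge_point P e t"
    using outside_arc0[of x] top x by (metis insertCI insert_subset)
  define T where "T = {s \<in> {0..1}. edge_point P e s \<in> {x, y, z}}"
  have T: "finite T" "t \<in> T" using finite_edge_param[of "{x, y, z}" e] t by (auto simp: T_def)
  define u where "u = Min T"
  have u: "u \<in> T" "\<And>s. s \<in> T \<Longrightarrow> u \<le> s" using T by (auto simp: u_def intro: Min_in)
  define p where "p = edge_point P e u"
  have p: "p \<in> {x, y, z}" and u01: "u \<in> {0..1}" using u(1) by (auto simp: T_def p_def)
  obtain q r where qr: "{p, q, r} = {x, y, z}" "distinct [p, q, r]"
  proof -
    have "{x, z, y} = {x, y, z}" "{y, x, z} = {x, y, z}" "{z, x, y} = {x, y, z}" by auto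
    then show thesis using p(1) d that[of y z] that[of x z] that[of x y] by auto
  qed
  have qr_top: "q \<in> topspace \<Gamma>" "r \<in> topspace \<Gamma>" using qr(1) top by auto
  define h where "h = edge_point P e 0"
  have h: "h = Vertex Hub1 \<or> h = Vertex Hub2" unfolding h_def by (rule edge_point_0)
  have "edge_point P e s \<notin> {q, r}" if "s \<in> closed_segment u 0" for s
  proof
    have s: "s \<in> {0..1}" "s \<le> u" using that u01 by (auto simp: closed_segment_eq_real_ivl split: if_splits)
    assume *: "edge_point P e s \<in> {q, r}"
    then have "s \<in> T" using qr(1) s(1) by (auto simp: T_def)
    then have "s = u" using u(2) s(2) by force
    then show False using * qr(2) by (auto simp: p_def)
  qed
  then have 1: "path_component_of (Conf 3 \<Gamma>) (conf3 p q r) (conf3 h q r)"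
    unfolding p_def h_def using e(1) u01 qr_top qr(2)
    by (intro path_component_move_along_edge) auto
  have "h \<notin> {x, y, z}" using h False by blast
  then have hqr: "distinct [h, q, r]" using qr by auto
  obtain p' where p': "p' \<in> arc0" "p' \<notin> {q, r}"
    "path_component_of (Conf 3 \<Gamma>) (conf3 h q r) (conf3 p' q r)"
    using hub_to_arc0[OF h qr_top hqr] by blast
  have "p \<notin> arc0"
    using e(2) by (cases e) (auto simp: p_def arc0_def edge_point_simps)
  then show thesis
    using that[OF qr _ p'(1,2)] path_component_of_trans[OF 1 p'(3)] conf3_cong_set[OF qr d] by simp
qed

lemma move_all_to_arc0:
  assumes "{x, y, z} \<subseteq> topspace \<Gamma>" "distinct [x, y, z]"
  shows "\<exists>x' y' z'. {x', y', z'} \<subseteq> arc0 \<and> distinct [x', y', z'] \<and>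
    path_component_of (Conf 3 \<Gamma>) (conf3 x y z) (conf3 x' y' z')"
  using assms
proof (induction "card ({x, y, z} - arc0)" arbitrary: x y z rule: less_induct)
  case less
  show ?case
  proof (cases "{x, y, z} \<subseteq> arc0")
    case True
    have "conf3 x y z \<in> topspace (Conf 3 \<Gamma>)" using less.prems by (intro conf3_in_topspace) auto
    then have "path_component_of (Conf 3 \<Gamma>) (conf3 x y z) (conf3 x y z)"
      by (simp add: path_component_of_refl)
    then show ?thesis using True less.prems(2) by (intro exI conjI)
  next
    case False
    then obtain a where a: "a \<in> {x, y, z}" "a \<notin> arc0" by blast
    obtain b c where bc: "{a, b, c} = {x, y, z}" "distinct [a, b, c]"
    proof -
      have "{x, z, y} = {x, y, z}" "{y, x, z} = {x, y, z}" "{z, x, y} = {x, y, z}" by auto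
      then show thesis using a(1) less.prems(2) that[of y z] that[of x z] that[of x y] by auto
    qed
    have "{a, b, c} \<subseteq> topspace \<Gamma>" using bc less.prems by simp
    then obtain p q r p' where p: "{p, q, r} = {a, b, c}" "distinct [p, q, r]" "p \<notin> arc0"
      "p' \<in> arc0" "p' \<notin> {q, r}" "path_component_of (Conf 3 \<Gamma>) (conf3 a b c) (conf3 p' q r)"
      using bc(2) a(2) by (rule move_one_to_arc0)
    have set: "{x, y, z} - arc0 = insert p ({p', q, r} - arc0)" "p \<notin> {p', q, r} - arc0"
      using p(1-5) bc(1) by auto
    then have "card ({p', q, r} - arc0) < card ({x, y, z} - arc0)"
      by (simp add: card_insert_if)
    moreover have "{p', q, r} \<subseteq> topspace \<Gamma>"
    proof -
      have "{q, r} \<subseteq> {a, b, c}" unfolding p(1)[symmetric] by blast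
      then show ?thesis using \<open>{a, b, c} \<subseteq> topspace \<Gamma>\<close> p(4) arc0_subset by blast
    qed
    moreover have "distinct [p', q, r]" using p(2,5) by simp
    ultimately obtain x' y' z' where "{x', y', z'} \<subseteq> arc0" "distinct [x', y', z']"
      "path_component_of (Conf 3 \<Gamma>) (conf3 p' q r) (conf3 x' y' z')"
      using less.hyps by blast
    moreover have "conf3 a b c = conf3 x y z" by (rule conf3_cong_set[OF bc less.prems(2)])
    ultimately show ?thesis using path_component_of_trans[OF p(6)] by (intro exI conjI) simp_all
  qed
qed

lemma sorted_arc0_standard:
  assumes "0 < a" "a < b" "b < c" "c < 1"
  shows "path_component_of (Conf 3 \<Gamma>) (conf3 (Inner (Arc 0) a) (Inner (Arc 0) b) (Inner (Arc 0) c))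
    (conf3 (Inner (Arc 0) (1/4)) (Inner (Arc 0) (1/2)) (Inner (Arc 0) (3/4)))"
proof -
  let ?p = "\<lambda>a b t. edge_point P (Arc 0) ((1 - t) * a + t * b)"
  have mono: "(1 - t) * u + t * v < (1 - t) * u' + t * v'" if "u < u'" "v < v'" "t \<in> {0..1}" for t u v u' v' :: real
  proof (cases "t = 0")
    case False
    then have "t * v < t * v'" "(1 - t) * u \<le> (1 - t) * u'"
      using that by (auto intro: mult_left_mono)
    then show ?thesis by linarith
  qed (use that in simp)
  have "?p a (1/4) t \<noteq> ?p b (1/2) t \<and> ?p b (1/2) t \<noteq> ?p c (3/4) t \<and> ?p a (1/4) t \<noteq> ?p c (3/4) t"
    if t: "t \<in> {0..1}" for t
  proof -
    have conv: "(1 - t) * u + t * v \<in> {0..1}" if "u \<in> {0..1}" "v \<in> {0..1}" for u v :: real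
      using convexD[OF convex_real_interval(5) that, of "1 - t" t] t by simp
    have neq: "edge_point P (Arc 0) u \<noteq> edge_point P (Arc 0) v"
      if "u < v" "u \<in> {0..1}" "v \<in> {0..1}" for u v
      using edge_point_inj[of "Arc 0" u v] that by auto
    have lt: "(1 - t) * a + t * (1/4) < (1 - t) * b + t * (1/2)" "(1 - t) * b + t * (1/2) < (1 - t) * c + t * (3/4)"
      using assms t by (intro mono; simp)+
    have in01: "(1 - t) * a + t * (1/4) \<in> {0..1}" "(1 - t) * b + t * (1/2) \<in> {0..1}"
      "(1 - t) * c + t * (3/4) \<in> {0..1}"
      using assms by (intro conv; simp)+
    show ?thesis
      by (intro conjI neq in01 lt less_trans[OF lt])
  qed
  then have d: "distinct [?p a (1/4) t, ?p b (1/2) t, ?p c (3/4) t]" if "t \<in> {0..1}" for t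
    using that by simp
  have path: "pathin \<Gamma> (?p u v)" if "u \<in> {0..1}" "v \<in> {0..1}" for u v
    by (rule pathin_along_edge[OF Arc_in_arcs[OF m] that])
  have "path_component_of (Conf 3 \<Gamma>) (conf3 (?p a (1/4) 0) (?p b (1/2) 0) (?p c (3/4) 0))
      (conf3 (?p a (1/4) 1) (?p b (1/2) 1) (?p c (3/4) 1))"
    by (rule path_component_moveI[OF path path path d]) (use assms in auto)
  then show ?thesis using assms by (simp add: edge_point_simps)
qed

lemma path_component_standard:
  assumes "A \<in> topspace (Conf 3 \<Gamma>)"
  shows "path_component_of (Conf 3 \<Gamma>) A
    (conf3 (Inner (Arc 0) (1/4)) (Inner (Arc 0) (1/2)) (Inner (Arc 0) (3/4)))"
proof -
  obtain x y z where "{x, y, z} \<subseteq> topspace \<Gamma>" "distinct [x, y, z]" and A: "A = conf3 x y z"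
    using topspace_Conf_3E[OF assms] by (metis empty_subsetI insert_subset)
  then obtain x' y' z' where xyz: "{x', y', z'} \<subseteq> arc0" "distinct [x', y', z']"
    "path_component_of (Conf 3 \<Gamma>) A (conf3 x' y' z')"
    using move_all_to_arc0 by blast
  obtain a b c where abc: "x' = Inner (Arc 0) a" "y' = Inner (Arc 0) b" "z' = Inner (Arc 0) c"
    "0 < a" "a < 1" "0 < b" "b < 1" "0 < c" "c < 1"
    using xyz(1) by (auto simp: arc0_def)
  have ne: "a \<noteq> b" "b \<noteq> c" "a \<noteq> c" using xyz(2) abc by auto
  let ?C = "\<lambda>a b c. conf3 (Inner (Arc 0) a :: (pulsar_vertex, pulsar_edge) graph_point) (Inner (Arc 0) b) (Inner (Arc 0) c)"
  have perms: "?C a b c = ?C a c b" "?C a b c = ?C b a c" "?C a b c = ?C b c a"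
    "?C a b c = ?C c a b" "?C a b c = ?C c b a"
    by (rule conf3_cong_set; use ne in auto)+
  obtain u v w where uvw: "?C a b c = ?C u v w" "u < v" "v < w" "{u, v, w} = {a, b, c}"
  proof -
    consider "a < b" "b < c" | "a < c" "c < b" | "b < a" "a < c" | "b < c" "c < a"
      | "c < a" "a < b" | "c < b" "b < a"
      using ne by linarith
    then show thesis
    proof cases
      case 1 with that[of a b c] show thesis by simp
    next
      case 2 with that[OF perms(1)] show thesis by auto
    next
      case 3 with that[OF perms(2)] show thesis by auto
    next
      case 4 with that[OF perms(3)] show thesis by auto
    next
      case 5 with that[OF perms(4)] show thesis by auto
    next
      case 6 with that[OF perms(5)] show thesis by auto
    qed
  qed
  have "u \<in> {a, b, c}" "w \<in> {a, b, c}" using uvw(4) by auto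
  then have "0 < u" "w < 1" using abc by auto
  then have "path_component_of (Conf 3 \<Gamma>) (?C a b c) (?C (1/4) (1/2) (3/4))"
    unfolding uvw(1) using uvw(2,3) by (intro sorted_arc0_standard)
  then show ?thesis using path_component_of_trans[OF xyz(3)] by (simp only: abc(1-3))
qed

lemma path_connected_Conf:
  assumes "A \<in> topspace (Conf 3 \<Gamma>)" "B \<in> topspace (Conf 3 \<Gamma>)"
  shows "path_component_of (Conf 3 \<Gamma>) A B"
  using path_component_standard[OF assms(1)] path_component_standard[OF assms(2)]
  by (meson path_component_of_sym path_component_of_trans)

end

section \<open>Two double covers of the configuration space\<close>

definition phase :: "(pulsar_vertex, pulsar_edge) graph_point \<Rightarrow> complex" where
  "phase x = (case x of Inner (Arc i) t \<Rightarrow> if i = 0 then cis (2 * pi * t) else 1 | _ \<Rightarrow> 1)"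

text \<open>
  A continuous square root of \<open>phase\<close> along the closed curve through arc \<open>0\<close> and a second arc,
  opened up to an interval: arc \<open>0\<close> is \<open>[0, 1]\<close>, and the root is constant on either side of it,
  with opposite values.
\<close>

definition half_phase :: "real \<Rightarrow> complex" where
  "half_phase x = cis (pi * max 0 (min 1 x))"

text \<open>
  A planar embedding in which the first coordinate tells the arcs and the two families of rays
  apart.  Within each family the members are distinguished by their slopes, or by the heights
  of parabolas in the case of the arcs.
\<close>

definition plane :: "(pulsar_vertex, pulsar_edge) graph_point \<Rightarrow> complex" where
  "plane x = (case x of
     Vertex v \<Rightarrow> (case v of Hub1 \<Rightarrow> 0 | Hub2 \<Rightarrow> 1 | Tip1 j \<Rightarrow> Complex (-1) j | Tip2 j \<Rightarrow> Complex 2 j)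
   | Inner e t \<Rightarrow> (case e of Arc i \<Rightarrow> Complex t (i * (t * (1 - t)))
       | Ray1 j \<Rightarrow> Complex (- t) (j * t) | Ray2 j \<Rightarrow> Complex (1 + t) (j * t)))"

definition vandermonde ::
  "(pulsar_vertex, pulsar_edge) graph_point \<Rightarrow> (pulsar_vertex, pulsar_edge) graph_point \<Rightarrow>
     (pulsar_vertex, pulsar_edge) graph_point \<Rightarrow> complex" where
  "vandermonde a b c = (plane a - plane b) * (plane a - plane c) * (plane b - plane c)"

lemma continuous_on_Complex:
  "continuous_on S f \<Longrightarrow> continuous_on S g \<Longrightarrow> continuous_on S (\<lambda>x. Complex (f x) (g x))"
  unfolding Complex_eq by (intro continuous_intros)

lemma continuous_map_complex_mult:
  fixes f g :: "'a \<Rightarrow> complex"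
  assumes "continuous_map X euclidean f" "continuous_map X euclidean g"
  shows "continuous_map X euclidean (\<lambda>x. f x * g x)"
  using assms by (simp add: continuous_map_atin tendsto_mult)

context pulsar_graph begin

lemma continuous_map_phase: "continuous_map \<Gamma> euclidean phase"
proof (rule continuous_map_from_graph_space)
  fix e assume "e \<in> arcs P"
  show "continuous_map (top_of_set {0..1}) euclidean (\<lambda>t. phase (edge_point P e t))"
  proof (cases "e = Arc 0")
    case True
    have "phase (edge_point P e t) = cis (2 * pi * t)" for t
      by (simp add: True edge_point_simps phase_def)
    then show ?thesis by (simp add: continuous_intros)
  next
    case False
    then have "phase (edge_point P e t) = 1" for t
      by (cases e) (simp_all add: edge_point_simps phase_def)
    then show ?thesis by simp
  qed
qed simp

lemma plane_edge_point:
  "plane (edge_point P (Arc i) t) = Complex t (i * (t * (1 - t)))"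
  "plane (edge_point P (Ray1 j) t) = Complex (- t) (j * t)"
  "plane (edge_point P (Ray2 j) t) = Complex (1 + t) (j * t)"
  by (simp_all add: edge_point_simps plane_def complex_eq_iff)

lemma continuous_map_plane: "continuous_map \<Gamma> euclidean plane"
proof (rule continuous_map_from_graph_space)
  fix e assume "e \<in> arcs P"
  have "continuous_on {0..1} (\<lambda>t. plane (edge_point P e t))"
    by (cases e; simp only: plane_edge_point; intro continuous_on_Complex continuous_intros)
  then show "continuous_map (top_of_set {0..1}) euclidean (\<lambda>t. plane (edge_point P e t))" by simp
qed simp

lemma inj_on_plane: "inj_on plane (topspace \<Gamma>)"
proof (rule inj_onI)
  have mid: "plane (Inner (Arc i) t) = Complex t (i * (t * (1 - t)))"
    "plane (Inner (Ray1 j) t) = Complex (- t) (j * t)"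
    "plane (Inner (Ray2 j) t) = Complex (1 + t) (j * t)" for i j t
    by (simp_all add: plane_def)
  have vert: "plane (Vertex Hub1) = Complex 0 0" "plane (Vertex Hub2) = Complex 1 0"
    "plane (Vertex (Tip1 j)) = Complex (-1) j" "plane (Vertex (Tip2 j)) = Complex 2 j" for j
    by (simp_all add: plane_def complex_eq_iff)
  fix x y assume "x \<in> topspace \<Gamma>" "y \<in> topspace \<Gamma>" and eq: "plane x = plane y"
  then consider v w where "x = Vertex v" "y = Vertex w"
    | v e t where "x = Vertex v" "y = Inner e t" "0 < t" "t < 1"
    | v e t where "x = Inner e t" "y = Vertex v" "0 < t" "t < 1"
    | e s f t where "x = Inner e s" "y = Inner f t" "0 < s" "s < 1" "0 < t" "t < 1"
    unfolding topspace_\<Gamma> by blast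
  then show "x = y"
  proof cases
    case 1
    then show ?thesis using eq by (cases v; cases w) (simp_all add: vert)
  next
    case 2
    then show ?thesis using eq by (cases v; cases e) (simp_all add: vert mid)
  next
    case 3
    then show ?thesis using eq by (cases v; cases e) (simp_all add: vert mid)
  next
    case 4
    then show ?thesis using eq by (cases e; cases f) (auto simp: mid)
  qed
qed

lemma phase_cover:
  obtains F where "nonvanishing_map (Conf 3 \<Gamma>) F"
    and "\<And>a b c. {a, b, c} \<subseteq> topspace \<Gamma> \<Longrightarrow> distinct [a, b, c]
          \<Longrightarrow> F (conf3 a b c) = phase a * phase b * phase c"
proof -
  have c: "continuous_map (ordered_conf 3 \<Gamma>) euclidean (\<lambda>x. phase (x i))" if "i < 3" for i
    using continuous_map_ordered_conf_component[OF continuous_map_phase that] .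
  have "continuous_map (ordered_conf 3 \<Gamma>) euclidean (\<lambda>x. phase (x 0) * phase (x 1) * phase (x 2))"
    by (intro continuous_map_complex_mult c) simp_all
  moreover have "phase a * phase b * phase c \<noteq> 0" for a b c
    by (simp add: phase_def split: graph_point.split pulsar_edge.split)
  moreover have "phase a * phase b * phase c = phase b * phase a * phase c"
    "phase a * phase b * phase c = phase a * phase c * phase b" for a b c
    by (simp_all add: mult_ac)
  ultimately obtain F where "nonvanishing_map (Conf 3 \<Gamma>) F"
    "\<And>a b c. \<lbrakk>a \<in> topspace \<Gamma>; b \<in> topspace \<Gamma>; c \<in> topspace \<Gamma>; distinct [a, b, c]\<rbrakk>
          \<Longrightarrow> F (conf3 a b c) = phase a * phase b * phase c"
    by (rule_tac symmetric_map_on_Conf[of "\<lambda>a b c. phase a * phase b * phase c" \<Gamma>]) blast+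
  then show thesis using that[of F] by simp
qed

lemma discriminant_cover:
  obtains F where "nonvanishing_map (Conf 3 \<Gamma>) F"
    and "\<And>a b c. {a, b, c} \<subseteq> topspace \<Gamma> \<Longrightarrow> distinct [a, b, c]
          \<Longrightarrow> F (conf3 a b c) = (vandermonde a b c)\<^sup>2"
proof -
  have c: "continuous_map (ordered_conf 3 \<Gamma>) euclidean (\<lambda>x. plane (x i))" if "i < 3" for i
    using continuous_map_ordered_conf_component[OF continuous_map_plane that] .
  have "continuous_map (ordered_conf 3 \<Gamma>) euclidean (\<lambda>x. (vandermonde (x 0) (x 1) (x 2))\<^sup>2)"
    unfolding vandermonde_def power2_eq_square by (intro continuous_map_complex_mult continuous_map_diff c) simp_all
  moreover have "(vandermonde a b c)\<^sup>2 \<noteq> 0"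
    if "a \<in> topspace \<Gamma>" "b \<in> topspace \<Gamma>" "c \<in> topspace \<Gamma>" "distinct [a, b, c]" for a b c
    using that inj_on_plane by (simp add: vandermonde_def inj_on_eq_iff)
  moreover have "(vandermonde a b c)\<^sup>2 = (vandermonde b a c)\<^sup>2" for a b c
    unfolding vandermonde_def by algebra
  moreover have "(vandermonde a b c)\<^sup>2 = (vandermonde a c b)\<^sup>2" for a b c
    unfolding vandermonde_def by algebra
  ultimately obtain F where "nonvanishing_map (Conf 3 \<Gamma>) F"
    "\<And>a b c. \<lbrakk>a \<in> topspace \<Gamma>; b \<in> topspace \<Gamma>; c \<in> topspace \<Gamma>; distinct [a, b, c]\<rbrakk>
          \<Longrightarrow> F (conf3 a b c) = (vandermonde a b c)\<^sup>2"
    by (rule_tac symmetric_map_on_Conf[of "\<lambda>a b c. (vandermonde a b c)\<^sup>2" \<Gamma>]) blast+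
  then show thesis using that[of F] by simp
qed

end

section \<open>Cells of the surface\<close>

text \<open>
  Coordinates of three particles that travel along \<open>cycle_path\<close> for three different arcs: two
  of them can only meet on arc \<open>0\<close>.
\<close>

definition apart :: "real \<Rightarrow> real \<Rightarrow> real \<Rightarrow> bool" where
  "apart x y z \<longleftrightarrow> {x, y, z} \<subseteq> {-1<..<2} \<and> (x \<noteq> y \<or> x \<notin> {0..1}) \<and> (x \<noteq> z \<or> x \<notin> {0..1})
     \<and> (y \<noteq> z \<or> y \<notin> {0..1})"

definition labelling :: "nat \<Rightarrow> nat \<Rightarrow> nat \<Rightarrow> bool" where
  "labelling i j k \<longleftrightarrow> {i, j, k} \<subseteq> {1, 2, 3} \<and> distinct [i, j, k]"

context pulsar_graph begin

text \<open>
  The parameters \<open>-1/2\<close> and \<open>3/2\<close> both denote the middle of arc \<open>j\<close>, reached from arc \<open>0\<close> through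
  \<open>Hub1\<close> and \<open>Hub2\<close> respectively.  In this coordinate both kinds of moves are linear.
\<close>

definition cycle_path :: "nat \<Rightarrow> real \<Rightarrow> (pulsar_vertex, pulsar_edge) graph_point" where
  "cycle_path j x = (if x \<le> 0 then edge_point P (Arc j) (- x)
     else if x \<le> 1 then edge_point P (Arc 0) x else edge_point P (Arc j) (2 - x))"

lemma continuous_map_edge_compose:
  assumes "e \<in> arcs P" "continuous_on S h" "h ` S \<subseteq> {0..1}"
  shows "continuous_map (top_of_set S) \<Gamma> (\<lambda>x. edge_point P e (h x))"
proof -
  have "continuous_map (top_of_set S) (top_of_set {0..1}) h" using assms by auto
  from continuous_map_compose[OF this continuous_map_edge[OF assms(1)]] show ?thesis
    by (simp add: o_def)
qed

lemma continuous_map_cycle_path: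
  assumes j: "j < m"
  shows "continuous_map (top_of_set {-1..2}) \<Gamma> (cycle_path j)"
  unfolding cycle_path_def
proof (rule continuous_map_cases_le)
  let ?X = "top_of_set {-1..2::real}"
  have sub: "subtopology ?X {x \<in> topspace ?X. x \<le> 0} = top_of_set {-1..0}"
    "subtopology ?X {x \<in> topspace ?X. 0 \<le> x} = top_of_set {0..2}"
    by (auto simp: subtopology_subtopology intro!: arg_cong[where f = top_of_set])
  show "continuous_map (subtopology ?X {x \<in> topspace ?X. x \<le> 0}) \<Gamma> (\<lambda>x. edge_point P (Arc j) (- x))"
    unfolding sub by (rule continuous_map_edge_compose) (use j in \<open>auto simp: Arc_in_arcs intro!: continuous_intros\<close>)
  show "continuous_map (subtopology ?X {x \<in> topspace ?X. 0 \<le> x}) \<Gamma>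
      (\<lambda>x. if x \<le> 1 then edge_point P (Arc 0) x else edge_point P (Arc j) (2 - x))"
    unfolding sub
  proof (rule continuous_map_cases_le)
    let ?Y = "top_of_set {0..2::real}"
    have sub': "subtopology ?Y {x \<in> topspace ?Y. x \<le> 1} = top_of_set {0..1}"
      "subtopology ?Y {x \<in> topspace ?Y. 1 \<le> x} = top_of_set {1..2}"
      by (auto simp: subtopology_subtopology intro!: arg_cong[where f = top_of_set])
    show "continuous_map (subtopology ?Y {x \<in> topspace ?Y. x \<le> 1}) \<Gamma> (edge_point P (Arc 0))"
      unfolding sub' by (rule continuous_map_edge) (rule Arc_in_arcs[OF m])
    show "continuous_map (subtopology ?Y {x \<in> topspace ?Y. 1 \<le> x}) \<Gamma> (\<lambda>x. edge_point P (Arc j) (2 - x))"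
      unfolding sub' by (rule continuous_map_edge_compose) (use j in \<open>auto simp: Arc_in_arcs intro!: continuous_intros\<close>)
  qed (auto simp: edge_point_simps)
qed (auto simp: edge_point_simps)

lemma cycle_path_arc0: "x \<in> {0..1} \<Longrightarrow> cycle_path j x = edge_point P (Arc 0) x"
  by (auto simp: cycle_path_def edge_point_simps)

lemma cycle_path_middle: "cycle_path j (-1/2) = edge_point P (Arc j) (1/2)"
  "cycle_path j (3/2) = edge_point P (Arc j) (1/2)"
  by (simp_all add: cycle_path_def)

lemma cycle_path_neq:
  assumes "j \<noteq> k" "j \<noteq> 0" "k \<noteq> 0" "x \<in> {-1<..<2}" "y \<in> {-1<..<2}" "x \<noteq> y \<or> x \<notin> {0..1}"
  shows "cycle_path j x \<noteq> cycle_path k y"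
  using assms by (auto simp: cycle_path_def edge_point_simps split: if_splits)

lemma cycle_path_in_topspace:
  assumes "j < m" "x \<in> {-1<..<2}"
  shows "cycle_path j x \<in> topspace \<Gamma>"
  using continuous_map_image_subset_topspace[OF continuous_map_cycle_path[OF assms(1)]] assms(2)
  by (auto simp: image_subset_iff)

lemma phase_cycle_path:
  assumes "j \<noteq> 0" "x \<in> {-1<..<2}"
  shows "phase (cycle_path j x) = (half_phase x)\<^sup>2"
proof -
  consider "x \<le> 0" | "0 < x" "x < 1" | "1 \<le> x" by linarith
  then show ?thesis
  proof cases
    case 1
    then show ?thesis using assms by (auto simp: cycle_path_def edge_point_simps phase_def half_phase_def)
  next
    case 2
    then show ?thesis
      using cis_mult[of "pi * x" "pi * x"]
      by (simp add: cycle_path_def edge_point_simps phase_def half_phase_def power2_eq_square mult.assoc)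
  next
    case 3
    then have "half_phase x = -1" by (simp add: half_phase_def)
    then show ?thesis using 3 assms by (auto simp: cycle_path_def edge_point_simps phase_def)
  qed
qed

lemma continuous_half_phase: "continuous_on S f \<Longrightarrow> continuous_on S (\<lambda>s. half_phase (f s))"
  unfolding half_phase_def by (intro continuous_intros)

end

locale pulsar_graph4 = pulsar_graph +
  assumes four: "4 \<le> m"
begin

definition cell :: "nat \<Rightarrow> nat \<Rightarrow> nat \<Rightarrow> real \<Rightarrow> real \<Rightarrow> real \<Rightarrow> (nat \<Rightarrow> (pulsar_vertex, pulsar_edge) graph_point) set" where
  "cell i j k x y z = conf3 (cycle_path i x) (cycle_path j y) (cycle_path k z)"

lemma labelling_less: "labelling i j k \<Longrightarrow> i < m \<and> j < m \<and> k < m \<and> i \<noteq> 0 \<and> j \<noteq> 0 \<and> k \<noteq> 0"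
  using four by (auto simp: labelling_def)

lemma cell_points:
  assumes "labelling i j k" "apart x y z"
  shows "{cycle_path i x, cycle_path j y, cycle_path k z} \<subseteq> topspace \<Gamma>"
    and "distinct [cycle_path i x, cycle_path j y, cycle_path k z]"
proof -
  have l: "i < m" "j < m" "k < m" "i \<noteq> 0" "j \<noteq> 0" "k \<noteq> 0" "i \<noteq> j" "i \<noteq> k" "j \<noteq> k"
    using labelling_less[OF assms(1)] assms(1) by (auto simp: labelling_def)
  have a: "x \<in> {-1<..<2}" "y \<in> {-1<..<2}" "z \<in> {-1<..<2}" "x \<noteq> y \<or> x \<notin> {0..1}" "x \<noteq> z \<or> x \<notin> {0..1}"
    "y \<noteq> z \<or> y \<notin> {0..1}" using assms(2) unfolding apart_def by blast+
  show "{cycle_path i x, cycle_path j y, cycle_path k z} \<subseteq> topspace \<Gamma>"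
    using cycle_path_in_topspace[OF l(1) a(1)] cycle_path_in_topspace[OF l(2) a(2)]
      cycle_path_in_topspace[OF l(3) a(3)] by simp
  show "distinct [cycle_path i x, cycle_path j y, cycle_path k z]"
    using cycle_path_neq[OF l(7,4,5) a(1,2,4)] cycle_path_neq[OF l(8,4,6) a(1,3,5)]
      cycle_path_neq[OF l(9,5,6) a(2,3,6)] by simp
qed

lemma continuous_map_cycle_path_compose:
  assumes "j < m" "continuous_on S x" "\<And>s. s \<in> S \<Longrightarrow> x s \<in> {-1<..<2}"
  shows "continuous_map (top_of_set S) \<Gamma> (\<lambda>s. cycle_path j (x s))"
proof -
  have "x ` S \<subseteq> {-1..2}" using assms(3) by force
  then have "continuous_map (top_of_set S) (top_of_set {-1..2}) x" using assms(2) by auto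
  from continuous_map_compose[OF this continuous_map_cycle_path[OF assms(1)]] show ?thesis
    by (simp add: o_def)
qed

lemma continuous_map_cell:
  assumes l: "labelling i j k" and c: "continuous_on S x" "continuous_on S y" "continuous_on S z"
    and a: "\<And>s. s \<in> S \<Longrightarrow> apart (x s) (y s) (z s)"
  shows "continuous_map (top_of_set S) (Conf 3 \<Gamma>) (\<lambda>s. cell i j k (x s) (y s) (z s))"
  unfolding cell_def
proof (rule continuous_map_conf3)
  have "x s \<in> {-1<..<2} \<and> y s \<in> {-1<..<2} \<and> z s \<in> {-1<..<2}" if "s \<in> S" for s
    using a[OF that] unfolding apart_def by blast
  then show "continuous_map (top_of_set S) \<Gamma> (\<lambda>s. cycle_path i (x s))"
    "continuous_map (top_of_set S) \<Gamma> (\<lambda>s. cycle_path j (y s))"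
    "continuous_map (top_of_set S) \<Gamma> (\<lambda>s. cycle_path k (z s))"
    using labelling_less[OF l] c by (intro continuous_map_cycle_path_compose; blast)+
  show "distinct [cycle_path i (x s), cycle_path j (y s), cycle_path k (z s)]"
    if "s \<in> topspace (top_of_set S)" for s
    using cell_points(2)[OF l a] that by simp
qed

definition cell_path :: "nat \<Rightarrow> nat \<Rightarrow> nat \<Rightarrow> (real \<Rightarrow> real) \<Rightarrow> (real \<Rightarrow> real) \<Rightarrow> (real \<Rightarrow> real) \<Rightarrow>
    (real \<Rightarrow> (nat \<Rightarrow> (pulsar_vertex, pulsar_edge) graph_point) set) \<Rightarrow> bool" where
  "cell_path i j k x y z p \<longleftrightarrow> labelling i j k \<and>
     continuous_on {0..1} x \<and> continuous_on {0..1} y \<and> continuous_on {0..1} z \<and>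
     (\<forall>s\<in>{0..1}. apart (x s) (y s) (z s) \<and> p s = cell i j k (x s) (y s) (z s))"

lemma pathin_cell_path:
  assumes "cell_path i j k x y z p"
  shows "pathin (Conf 3 \<Gamma>) p"
  unfolding pathin_def
proof (rule continuous_map_eq)
  show "continuous_map (top_of_set {0..1}) (Conf 3 \<Gamma>) (\<lambda>s. cell i j k (x s) (y s) (z s))"
    using assms by (intro continuous_map_cell) (simp_all add: cell_path_def)
qed (use assms in \<open>simp add: cell_path_def\<close>)

lemma sheet_change_phase:
  assumes F: "nonvanishing_map (Conf 3 \<Gamma>) F"
    "\<And>a b c. {a, b, c} \<subseteq> topspace \<Gamma> \<Longrightarrow> distinct [a, b, c] \<Longrightarrow> F (conf3 a b c) = phase a * phase b * phase c"
    and p: "cell_path i j k x y z p"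
    and a: "half_phase (x 0) * half_phase (y 0) * half_phase (z 0) = a"
    and b: "half_phase (x 1) * half_phase (y 1) * half_phase (z 1) = (if \<epsilon> = 0 then b else - b)"
  shows "sheet_change F a p b = \<epsilon>"
proof -
  interpret nonvanishing_map "Conf 3 \<Gamma>" F by (rule F(1))
  define S where "S s = half_phase (x s) * half_phase (y s) * half_phase (z s)" for s
  have l: "labelling i j k" using p by (simp add: cell_path_def)
  have "F (p s) = (S s)\<^sup>2" if "s \<in> {0..1}" for s
  proof -
    have *: "apart (x s) (y s) (z s)" "p s = cell i j k (x s) (y s) (z s)"
      using p that by (simp_all add: cell_path_def)
    have "x s \<in> {-1<..<2}" "y s \<in> {-1<..<2}" "z s \<in> {-1<..<2}" using *(1) unfolding apart_def by blast+
    then show ?thesis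
      unfolding *(2) cell_def F(2)[OF cell_points[OF l *(1)]] S_def power_mult_distrib
      using labelling_less[OF l] by (simp add: phase_cycle_path)
  qed
  moreover have "continuous_on {0..1} S"
    unfolding S_def using p by (intro continuous_on_mult continuous_half_phase) (simp_all add: cell_path_def)
  ultimately have S: "sqrt_along F p S" by (simp add: sqrt_along_def)
  show ?thesis
  proof (rule sheet_change_eqI[OF pathin_cell_path[OF p] S])
    show "S 0 = a" "S 1 = (if \<epsilon> = 0 then b else - b)" using a b by (simp_all add: S_def)
    then have "b\<^sup>2 = (S 1)\<^sup>2" by simp
    then show "b\<^sup>2 = F (p 1)" using S by (simp add: sqrt_along_def)
  qed
qed

lemma sheet_change_discriminant:
  assumes F: "nonvanishing_map (Conf 3 \<Gamma>) F"
    "\<And>a b c. {a, b, c} \<subseteq> topspace \<Gamma> \<Longrightarrow> distinct [a, b, c] \<Longrightarrow> F (conf3 a b c) = (vandermonde a b c)\<^sup>2"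
    and p: "cell_path i j k x y z p"
    and a: "vandermonde (cycle_path i (x 0)) (cycle_path j (y 0)) (cycle_path k (z 0)) = a"
    and b: "vandermonde (cycle_path i (x 1)) (cycle_path j (y 1)) (cycle_path k (z 1)) = (if \<epsilon> = 0 then b else - b)"
  shows "sheet_change F a p b = \<epsilon>"
proof -
  interpret nonvanishing_map "Conf 3 \<Gamma>" F by (rule F(1))
  define S where "S s = vandermonde (cycle_path i (x s)) (cycle_path j (y s)) (cycle_path k (z s))" for s
  have l: "labelling i j k" using p by (simp add: cell_path_def)
  have ap: "apart (x s) (y s) (z s)" "p s = cell i j k (x s) (y s) (z s)" if "s \<in> {0..1}" for s
    using p that by (simp_all add: cell_path_def)
  have "F (p s) = (S s)\<^sup>2" if "s \<in> {0..1}" for s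
    unfolding ap(2)[OF that] cell_def F(2)[OF cell_points[OF l ap(1)[OF that]]] S_def ..
  moreover have "continuous_on {0..1} S"
  proof -
    have "continuous_on {0..1} (\<lambda>s. plane (cycle_path h (f s)))"
      if "h < m" "continuous_on {0..1} f" "\<And>s. s \<in> {0..1} \<Longrightarrow> f s \<in> {-1<..<2}" for h f
      using continuous_map_compose[OF continuous_map_cycle_path_compose[OF that] continuous_map_plane]
      by (simp add: o_def)
    note plane = this
    have "x s \<in> {-1<..<2} \<and> y s \<in> {-1<..<2} \<and> z s \<in> {-1<..<2}" if "s \<in> {0..1}" for s
      using ap(1)[OF that] unfolding apart_def by blast
    then have "continuous_on {0..1} (\<lambda>s. plane (cycle_path i (x s)))"
      "continuous_on {0..1} (\<lambda>s. plane (cycle_path j (y s)))"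
      "continuous_on {0..1} (\<lambda>s. plane (cycle_path k (z s)))"
      using labelling_less[OF l] p unfolding cell_path_def by (intro plane; blast)+
    then show ?thesis unfolding S_def vandermonde_def by (intro continuous_on_mult continuous_on_diff)
  qed
  ultimately have S: "sqrt_along F p S" by (simp add: sqrt_along_def)
  show ?thesis
  proof (rule sheet_change_eqI[OF pathin_cell_path[OF p] S])
    show "S 0 = a" "S 1 = (if \<epsilon> = 0 then b else - b)" using a b by (simp_all add: S_def)
    then have "b\<^sup>2 = (S 1)\<^sup>2" by simp
    then show "b\<^sup>2 = F (p 1)" using S by (simp add: sqrt_along_def)
  qed
qed

end

section \<open>The surface and its squares\<close>

lemma apart_increasing: "-1 < x \<Longrightarrow> x < y \<Longrightarrow> y < z \<Longrightarrow> z < 2 \<Longrightarrow> apart x y z"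
  by (auto simp: apart_def)

lemma apart_one_parked: "-1 < x \<Longrightarrow> x < y \<Longrightarrow> y < 2 \<Longrightarrow> apart x y (-1/2)"
  by (auto simp: apart_def)

lemma apart_two_parked: "-1 < x \<Longrightarrow> x < 2 \<Longrightarrow> apart x (-1/2) (-1/2)" "-1 < x \<Longrightarrow> x < 2 \<Longrightarrow> apart (-1/2) x (-1/2)"
  by (auto simp: apart_def)

lemma half_phase_end [simp]: "half_phase (-1/2) = 1" "half_phase (-(1/2)) = 1" "half_phase (3/2) = -1"
  by (simp_all add: half_phase_def)

definition smaller_other :: "nat \<Rightarrow> nat" where "smaller_other q = (if q = 1 then 2 else 1)"
definition larger_other :: "nat \<Rightarrow> nat" where "larger_other q = (if q = 3 then 2 else 3)"

lemma labelling_others: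
  "labelling j k q \<Longrightarrow> j < k \<Longrightarrow> smaller_other q = j \<and> larger_other q = k"
  by (auto simp: labelling_def smaller_other_def larger_other_def)

lemma labelling_others_self: "q \<in> {1, 2, 3} \<Longrightarrow> labelling (smaller_other q) (larger_other q) q"
  by (auto simp: labelling_def smaller_other_def larger_other_def)

lemma labelling_perm:
  assumes "labelling j k q"
  shows "labelling j q k" "labelling k j q" "labelling k q j" "labelling q j k" "labelling q k j"
  using assms by (auto simp: labelling_def)

context pulsar_graph4 begin

abbreviation A :: "real \<Rightarrow> (pulsar_vertex, pulsar_edge) graph_point" where
  "A x \<equiv> edge_point P (Arc 0) x"

abbreviation M :: "nat \<Rightarrow> (pulsar_vertex, pulsar_edge) graph_point" where
  "M j \<equiv> edge_point P (Arc j) (1/2)"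

text \<open>
  The first component is the number of parked particles.  With one of them the second
  component is the occupied arc, and with two it is the arc that is still empty, so that each
  vertex of the surface has only one index.
\<close>

definition V :: "nat \<times> nat \<Rightarrow> (nat \<Rightarrow> (pulsar_vertex, pulsar_edge) graph_point) set" where
  "V = (\<lambda>(n, j). if n = 0 then conf3 (A (1/4)) (A (1/2)) (A (3/4))
     else if n = 1 then conf3 (A (1/4)) (A (3/4)) (M j)
     else if n = 2 then conf3 (M (smaller_other j)) (A (1/2)) (M (larger_other j))
     else conf3 (M 1) (M 2) (M 3))"

text \<open>
  The remaining particles on arc \<open>0\<close> spread out while one of them leaves, so that their final
  positions depend only on their number.
\<close>

definition "U\<^sub>0 j s = conf3 (cycle_path j (1/4 - 3/4 * s)) (A (1/2 - s/4)) (A (3/4))"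
definition "D\<^sub>0 k t = conf3 (A (1/4)) (A (1/2 + t/4)) (cycle_path k (3/4 + 3/4 * t))"
definition "U\<^sub>1 k j s = conf3 (cycle_path j (1/4 - 3/4 * s)) (A (3/4 - s/4)) (M k)"
definition "D\<^sub>1 j k t = conf3 (A (1/4 + t/4)) (cycle_path k (3/4 + 3/4 * t)) (M j)"
definition "U\<^sub>2 j s = conf3 (cycle_path j (1/2 - s)) (M (smaller_other j)) (M (larger_other j))"
definition "D\<^sub>2 k t = conf3 (cycle_path k (1/2 + t)) (M (smaller_other k)) (M (larger_other k))"

lemma conf3_others:
  assumes "labelling j k q"
  shows "conf3 x (M (smaller_other j)) (M (larger_other j)) = conf3 x (M k) (M q)"
proof (cases "k < q")
  case True
  then show ?thesis using labelling_others[OF labelling_perm(3)[OF assms]] by simp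
next
  case False
  then have "q < k" using assms by (auto simp: labelling_def)
  then show ?thesis using labelling_others[OF labelling_perm(5)[OF assms]] by (simp add: conf3_swap(2))
qed

lemma V_simps:
  "V (0, 0) = conf3 (A (1/4)) (A (1/2)) (A (3/4))"
  "V (1, j) = conf3 (A (1/4)) (A (3/4)) (M j)"
  "labelling j k q \<Longrightarrow> V (2, q) = conf3 (M j) (A (1/2)) (M k)"
  "labelling j k q \<Longrightarrow> V (3, 0) = conf3 (M j) (M k) (M q)"
proof -
  show "V (2, q) = conf3 (M j) (A (1/2)) (M k)" if "labelling j k q"
    using conf3_others[OF labelling_perm(4)[OF that]] by (simp add: V_def conf3_swap(1)[of _ "A (1/2)"])
  show "V (3, 0) = conf3 (M j) (M k) (M q)" if "labelling j k q"
    using that unfolding labelling_def V_def by (auto simp: conf3_swap)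
qed (simp_all add: V_def)

lemma V_cell:
  "V (0, 0) = cell 1 2 3 (1/4) (1/2) (3/4)"
  "V (1, q) = cell j k q (1/4) (3/4) (-1/2)"
  "labelling j k q \<Longrightarrow> V (2, q) = cell j q k (-1/2) (1/2) (-1/2)"
  "V (3, 0) = cell 1 2 3 (-1/2) (-1/2) (-1/2)"
proof -
  have l: "labelling 1 2 3" by (simp add: labelling_def)
  show "V (0, 0) = cell 1 2 3 (1/4) (1/2) (3/4)"
    unfolding V_simps(1) cell_def by (simp add: cycle_path_arc0)
  show "V (3, 0) = cell 1 2 3 (-1/2) (-1/2) (-1/2)"
    unfolding V_simps(4)[OF l] cell_def cycle_path_middle(1) ..
  show "V (1, q) = cell j k q (1/4) (3/4) (-1/2)"
    unfolding V_simps(2) cell_def cycle_path_middle(1) by (simp add: cycle_path_arc0)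
  show "V (2, q) = cell j q k (-1/2) (1/2) (-1/2)" if "labelling j k q"
    unfolding V_simps(3)[OF that] cell_def cycle_path_middle(1) by (simp add: cycle_path_arc0)
qed

lemma moves_cell_path:
  assumes l: "labelling j k q"
  shows "cell_path j q k (\<lambda>s. 1/4 - 3/4 * s) (\<lambda>s. 1/2 - s/4) (\<lambda>_. 3/4) (U\<^sub>0 j)"
    and "cell_path j q k (\<lambda>_. 1/4) (\<lambda>t. 1/2 + t/4) (\<lambda>t. 3/4 + 3/4 * t) (D\<^sub>0 k)"
    and "cell_path j q k (\<lambda>s. 1/4 - 3/4 * s) (\<lambda>s. 3/4 - s/4) (\<lambda>_. -1/2) (U\<^sub>1 k j)"
    and "cell_path q k j (\<lambda>t. 1/4 + t/4) (\<lambda>t. 3/4 + 3/4 * t) (\<lambda>_. -1/2) (D\<^sub>1 j k)"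
    and "cell_path j k q (\<lambda>s. 1/2 - s) (\<lambda>_. -1/2) (\<lambda>_. -1/2) (U\<^sub>2 j)"
    and "cell_path k j q (\<lambda>s. 1/2 + s) (\<lambda>_. -1/2) (\<lambda>_. -1/2) (D\<^sub>2 k)"
proof -
  note perm = labelling_perm[OF l]
  show "cell_path j q k (\<lambda>s. 1/4 - 3/4 * s) (\<lambda>s. 1/2 - s/4) (\<lambda>_. 3/4) (U\<^sub>0 j)"
    unfolding cell_path_def U\<^sub>0_def cell_def
    by (intro conjI ballI apart_increasing perm continuous_intros) (simp_all add: cycle_path_arc0)
  show "cell_path j q k (\<lambda>_. 1/4) (\<lambda>t. 1/2 + t/4) (\<lambda>t. 3/4 + 3/4 * t) (D\<^sub>0 k)"
    unfolding cell_path_def D\<^sub>0_def cell_def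
    by (intro conjI ballI apart_increasing perm continuous_intros) (simp_all add: cycle_path_arc0)
  show "cell_path j q k (\<lambda>s. 1/4 - 3/4 * s) (\<lambda>s. 3/4 - s/4) (\<lambda>_. -1/2) (U\<^sub>1 k j)"
    unfolding cell_path_def U\<^sub>1_def cell_def cycle_path_middle(1)
    by (intro conjI ballI apart_one_parked perm continuous_intros) (simp_all add: cycle_path_arc0)
  show "cell_path q k j (\<lambda>t. 1/4 + t/4) (\<lambda>t. 3/4 + 3/4 * t) (\<lambda>_. -1/2) (D\<^sub>1 j k)"
    unfolding cell_path_def D\<^sub>1_def cell_def cycle_path_middle(1)
    by (intro conjI ballI apart_one_parked perm continuous_intros) (simp_all add: cycle_path_arc0)
  show "cell_path j k q (\<lambda>s. 1/2 - s) (\<lambda>_. -1/2) (\<lambda>_. -1/2) (U\<^sub>2 j)"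
    unfolding cell_path_def U\<^sub>2_def cell_def cycle_path_middle(1) conf3_others[OF l]
    by (intro conjI ballI apart_two_parked l continuous_intros) simp_all
  show "cell_path k j q (\<lambda>s. 1/2 + s) (\<lambda>_. -1/2) (\<lambda>_. -1/2) (D\<^sub>2 k)"
    unfolding cell_path_def D\<^sub>2_def cell_def cycle_path_middle(1) conf3_others[OF perm(2)]
    by (intro conjI ballI apart_two_parked perm continuous_intros) simp_all
qed

lemma moves_ends:
  assumes l: "labelling j k q"
  shows "U\<^sub>0 j 0 = V (0, 0)" "U\<^sub>0 j 1 = V (1, j)" "D\<^sub>0 k 0 = V (0, 0)" "D\<^sub>0 k 1 = V (1, k)"
    "U\<^sub>1 k j 0 = V (1, k)" "U\<^sub>1 k j 1 = V (2, q)" "D\<^sub>1 j k 0 = V (1, j)" "D\<^sub>1 j k 1 = V (2, q)"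
    "U\<^sub>2 j 0 = V (2, j)" "U\<^sub>2 j 1 = V (3, 0)" "D\<^sub>2 k 0 = V (2, k)" "D\<^sub>2 k 1 = V (3, 0)"
proof -
  note perm = labelling_perm[OF l]
  note defs = U\<^sub>0_def D\<^sub>0_def U\<^sub>1_def D\<^sub>1_def U\<^sub>2_def D\<^sub>2_def
  note V = V_simps(1,2) V_simps(3)[OF l] V_simps(4)[OF l] V_simps(3)[OF perm(5)] V_simps(3)[OF perm(1)]
    conf3_others[OF l] conf3_others[OF perm(2)]
  have "U\<^sub>0 j 0 = V (0, 0) \<and> U\<^sub>0 j 1 = V (1, j) \<and> D\<^sub>0 k 0 = V (0, 0) \<and> D\<^sub>0 k 1 = V (1, k) \<and>
    U\<^sub>1 k j 0 = V (1, k) \<and> U\<^sub>1 k j 1 = V (2, q) \<and> D\<^sub>1 j k 0 = V (1, j) \<and> D\<^sub>1 j k 1 = V (2, q) \<and>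
    U\<^sub>2 j 0 = V (2, j) \<and> U\<^sub>2 j 1 = V (3, 0) \<and> D\<^sub>2 k 0 = V (2, k) \<and> D\<^sub>2 k 1 = V (3, 0)"
    unfolding defs V by (simp add: cycle_path_arc0 cycle_path_middle[simplified] conf3_swap)
  then show "U\<^sub>0 j 0 = V (0, 0)" "U\<^sub>0 j 1 = V (1, j)" "D\<^sub>0 k 0 = V (0, 0)" "D\<^sub>0 k 1 = V (1, k)"
    "U\<^sub>1 k j 0 = V (1, k)" "U\<^sub>1 k j 1 = V (2, q)" "D\<^sub>1 j k 0 = V (1, j)" "D\<^sub>1 j k 1 = V (2, q)"
    "U\<^sub>2 j 0 = V (2, j)" "U\<^sub>2 j 1 = V (3, 0)" "D\<^sub>2 k 0 = V (2, k)" "D\<^sub>2 k 1 = V (3, 0)"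
    by blast+
qed

lemma square_from_bottom:
  assumes l: "labelling j k q"
  shows "path_homotopic (Conf 3 \<Gamma>) (loop_join (U\<^sub>0 j) (D\<^sub>1 j k)) (loop_join (D\<^sub>0 k) (U\<^sub>1 k j))"
proof (rule path_homotopic_square)
  let ?x = "\<lambda>z::real \<times> real. 1/4 - 3/4 * fst z" and ?y = "\<lambda>z::real \<times> real. 1/2 - fst z / 4 + snd z / 4"
    and ?z = "\<lambda>z::real \<times> real. 3/4 + 3/4 * snd z"
  let ?H = "\<lambda>z. cell j q k (?x z) (?y z) (?z z)"
  show "continuous_map (top_of_set ({0..1} \<times> {0..1})) (Conf 3 \<Gamma>) ?H"
    by (intro continuous_map_cell labelling_perm(1)[OF l] apart_increasing continuous_intros) auto
  fix t :: real assume "t \<in> {0..1}"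
  then show "U\<^sub>0 j t = ?H (t, 0)" "D\<^sub>1 j k t = ?H (1, t)" "D\<^sub>0 k t = ?H (0, t)" "U\<^sub>1 k j t = ?H (t, 1)"
    unfolding U\<^sub>0_def D\<^sub>1_def D\<^sub>0_def U\<^sub>1_def cell_def
    by (simp_all add: cycle_path_arc0 cycle_path_middle[simplified] conf3_swap)
qed

text \<open>
  The position from which either moving particle leaves arc \<open>0\<close> depends on the progress of the
  other one; this is the bilinear term in the coordinates.
\<close>

lemma square_to_top:
  assumes l: "labelling j k q"
  shows "path_homotopic (Conf 3 \<Gamma>) (loop_join (U\<^sub>1 q j) (D\<^sub>2 k)) (loop_join (D\<^sub>1 q k) (U\<^sub>2 j))"
proof (rule path_homotopic_square)
  let ?w = "\<lambda>z::real \<times> real. (1 - fst z) * (1 - snd z)"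
  let ?x = "\<lambda>z. 1/2 - fst z - ?w z / 4" and ?y = "\<lambda>z. 1/2 + snd z + ?w z / 4"
  let ?H = "\<lambda>z. cell j k q (?x z) (?y z) (-1/2)"
  show "continuous_map (top_of_set ({0..1} \<times> {0..1})) (Conf 3 \<Gamma>) ?H"
  proof (rule continuous_map_cell[OF l])
    fix z :: "real \<times> real" assume z: "z \<in> {0..1} \<times> {0..1}"
    then have s: "0 \<le> fst z" "fst z \<le> 1" "0 \<le> snd z" "snd z \<le> 1" by auto
    have "0 \<le> ?w z" using s by simp
    moreover have "?w z \<le> 1 - fst z" using s mult_left_le[of "1 - snd z" "1 - fst z"] by simp
    moreover have "?w z \<le> 1 - snd z" using s mult_left_le_one_le[of "1 - snd z" "1 - fst z"] by simp
    moreover have "1 - fst z - snd z \<le> ?w z" using s by (simp add: algebra_simps)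
    ultimately show "apart (?x z) (?y z) (-1/2)" using s by (intro apart_one_parked; linarith)
  qed (intro continuous_intros; simp)+
  fix t :: real assume t: "t \<in> {0..1}"
  have arith: "1/2 - t - (1 - t) * (1 - 0) / 4 = 1/4 - 3/4 * t" "1/2 + 0 + (1 - t) * (1 - 0) / 4 = 3/4 - t/4"
    "1/2 - 1 - (1 - 1) * (1 - t) / 4 = -1/2" "1/2 + t + (1 - 1) * (1 - t) / 4 = 1/2 + t"
    "1/2 - 0 - (1 - 0) * (1 - t) / 4 = 1/4 + t/4" "1/2 + t + (1 - 0) * (1 - t) / 4 = 3/4 + 3/4 * t"
    "1/2 - t - (1 - t) * (1 - 1) / 4 = 1/2 - t" "1/2 + 1 + (1 - t) * (1 - 1) / 4 = 3/2"
    by (simp_all add: field_simps)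
  note perm = labelling_perm[OF l]
  show "U\<^sub>1 q j t = ?H (t, 0)" "D\<^sub>2 k t = ?H (1, t)" "D\<^sub>1 q k t = ?H (0, t)" "U\<^sub>2 j t = ?H (t, 1)"
    unfolding U\<^sub>1_def D\<^sub>2_def D\<^sub>1_def U\<^sub>2_def cell_def fst_conv snd_conv arith cycle_path_middle
      conf3_others[OF l] conf3_others[OF perm(2)]
    using t by (simp_all add: cycle_path_arc0 conf3_swap)
qed

end

section \<open>Evaluation of the cup product\<close>

text \<open>
  The indices stand for moves as follows: \<open>u\<^sub>0 j\<close> and \<open>d\<^sub>0 j\<close> start with no parked particle,
  \<open>u\<^sub>1 k j\<close> and \<open>d\<^sub>1 k j\<close> with one parked on arc \<open>k\<close>, and \<open>u\<^sub>2 j\<close> and \<open>d\<^sub>2 j\<close> with two parked particles;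
  in each case \<open>j\<close> is the arc that is reached.  The cocycle \<open>\<psi>\<close> takes the value \<open>\<psi> k j\<close> on the
  move \<open>u\<^sub>1 k j\<close> and \<open>s j\<close> on \<open>u\<^sub>2 j\<close>.  The sum over all squares contains every edge
  of the surface twice.
\<close>

lemma parity_sum:
  fixes u\<^sub>0 d\<^sub>0 u\<^sub>2 d\<^sub>2 s :: "nat \<Rightarrow> bit" and u\<^sub>1 d\<^sub>1 \<psi> :: "nat \<Rightarrow> nat \<Rightarrow> bit"
  assumes A: "\<And>j k q. labelling j k q \<Longrightarrow> u\<^sub>0 j + d\<^sub>1 j k = d\<^sub>0 k + u\<^sub>1 k j + \<psi> k j"
    and B: "\<And>j k q. labelling j k q \<Longrightarrow> u\<^sub>1 q j + d\<^sub>2 k = d\<^sub>1 q k + u\<^sub>2 j + s j"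
  shows "\<psi> 1 2 + \<psi> 2 1 + \<psi> 1 3 + \<psi> 3 1 + \<psi> 2 3 + \<psi> 3 2 = 0"
proof -
  have "\<psi> k j = u\<^sub>0 j + d\<^sub>0 k + d\<^sub>1 j k + d\<^sub>1 k q + u\<^sub>2 j + s j + d\<^sub>2 q" if l: "labelling k j q" for k j q
  proof -
    have l': "labelling j k q" "labelling j q k" using l by (auto simp: labelling_def)
    have "\<psi> k j = (d\<^sub>0 k + u\<^sub>1 k j + \<psi> k j) + d\<^sub>0 k + u\<^sub>1 k j"
      by (simp only: ac_simps bit_double bit_double_left add_0_left add_0_right)
    also have "\<dots> = u\<^sub>0 j + d\<^sub>1 j k + d\<^sub>0 k + u\<^sub>1 k j" by (simp only: A[OF l'(1), symmetric])
    also have "u\<^sub>1 k j = (u\<^sub>1 k j + d\<^sub>2 q) + d\<^sub>2 q" by (simp only: ac_simps bit_double bit_double_left add_0_left add_0_right)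
    also have "\<dots> = d\<^sub>1 k q + u\<^sub>2 j + s j + d\<^sub>2 q" by (simp only: B[OF l'(2)])
    finally show ?thesis by (simp only: ac_simps)
  qed
  note \<psi> = this
  have "labelling 1 2 3" "labelling 2 1 3" "labelling 1 3 2" "labelling 3 1 2" "labelling 2 3 1" "labelling 3 2 1"
    by (simp_all add: labelling_def)
  note this[THEN \<psi>]
  then show ?thesis
    by (simp only: ac_simps bit_double bit_double_left add_0_left add_0_right)
qed

context pulsar_graph4 begin

theorem fundamental_group_Conf_not_free:
  assumes c: "c \<in> topspace (Conf 3 \<Gamma>)"
  shows "\<not> is_free_group (fundamental_group (Conf 3 \<Gamma>) c)"
proof
  let ?X = "Conf 3 \<Gamma>"
  assume free: "is_free_group (fundamental_group ?X c)"
  obtain F where F: "nonvanishing_map ?X F"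
    "\<And>a b c. {a, b, c} \<subseteq> topspace \<Gamma> \<Longrightarrow> distinct [a, b, c] \<Longrightarrow> F (conf3 a b c) = phase a * phase b * phase c"
    using phase_cover by blast
  obtain G where G: "nonvanishing_map ?X G"
    "\<And>a b c. {a, b, c} \<subseteq> topspace \<Gamma> \<Longrightarrow> distinct [a, b, c] \<Longrightarrow> G (conf3 a b c) = (vandermonde a b c)\<^sup>2"
    using discriminant_cover by blast
  define I :: "(nat \<times> nat) set" where "I = {(0, 0), (3, 0)} \<union> {1, 2} \<times> {1, 2, 3}"
  \<comment> \<open>Parked particles count with the coordinate \<open>-1/2\<close>, where the half phase is \<open>1\<close>.
    A move through \<open>Hub2\<close> ends at the coordinate \<open>3/2\<close> of the same point instead, with half phase \<open>-1\<close>.\<close>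
  define r where "r = (\<lambda>(n::nat, j::nat). if n = 0 then half_phase (1/4) * half_phase (1/2) * half_phase (3/4)
    else if n = 1 then half_phase (1/4) * half_phase (3/4) else if n = 2 then half_phase (1/2) else 1)"
  \<comment> \<open>With two parked particles the root refers to the increasing order of their arcs, whereas
    \<open>U\<^sub>1 k j\<close> carries its root to the one with arc \<open>j\<close> first: exactly one of \<open>U\<^sub>1 k j\<close> and \<open>U\<^sub>1 j k\<close>
    ends at the chosen root.\<close>
  define r' where "r' = (\<lambda>(n, j). if n = 1 then vandermonde (A (1/4)) (A (3/4)) (M j)
    else if n = 2 then vandermonde (M (smaller_other j)) (A (1/2)) (M (larger_other j)) else csqrt (G (V (n, j))))"
  have F_cell: "F (cell i j k x y z) = (half_phase x * half_phase y * half_phase z)\<^sup>2"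
    if "labelling i j k" "apart x y z" for i j k x y z
  proof -
    have "x \<in> {-1<..<2}" "y \<in> {-1<..<2}" "z \<in> {-1<..<2}" using that(2) unfolding apart_def by blast+
    then show ?thesis
      unfolding cell_def F(2)[OF cell_points[OF that]] power_mult_distrib
      using labelling_less[OF that(1)] by (simp add: phase_cycle_path)
  qed
  have G_cell: "G (cell i j k x y z) = (vandermonde (cycle_path i x) (cycle_path j y) (cycle_path k z))\<^sup>2"
    if "labelling i j k" "apart x y z" for i j k x y z
    unfolding cell_def G(2)[OF cell_points[OF that]] ..
  have cell_top: "cell i j k x y z \<in> topspace ?X" if "labelling i j k" "apart x y z" for i j k x y z
    using cell_points[OF that] unfolding cell_def by (intro conf3_in_topspace) simp_all
  have l123: "labelling 1 2 3" by (simp add: labelling_def)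
  have ap: "apart (1/4) (1/2) (3/4)" "apart (1/4) (3/4) (-1/2)" "apart (-1/2) (1/2) (-1/2)"
    "apart (-1/2) (-1/2) (-1/2)" by (auto simp: apart_def)
  have vertex: "V i \<in> topspace ?X \<and> (r i)\<^sup>2 = F (V i) \<and> (r' i)\<^sup>2 = G (V i)" if "i \<in> I" for i
  proof -
    consider "i = (0, 0)" | "i = (3, 0)" | q where "i = (1, q)" "q \<in> {1, 2, 3}"
      | q where "i = (2, q)" "q \<in> {1, 2, 3}"
      using \<open>i \<in> I\<close> unfolding I_def by blast
    then show ?thesis
    proof cases
      case 1
      show ?thesis unfolding 1 using cell_top[OF l123 ap(1)] F_cell[OF l123 ap(1)]
        by (simp add: V_cell(1) r_def r'_def)
    next
      case 2
      show ?thesis unfolding 2 using cell_top[OF l123 ap(4)] F_cell[OF l123 ap(4)]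
        by (simp add: V_cell(4) r_def r'_def)
    next
      case 3
      then obtain j k where l: "labelling j k q" using labelling_others_self by blast
      show ?thesis unfolding 3(1) V_cell(2)[of q j k] using cell_top[OF l ap(2)] F_cell[OF l ap(2)] G_cell[OF l ap(2)]
        by (simp add: r_def r'_def cycle_path_arc0 cycle_path_middle[simplified])
    next
      case 4
      then obtain j k where l: "labelling j k q" "j = smaller_other q" "k = larger_other q"
        using labelling_others_self by blast
      note l' = labelling_perm(1)[OF l(1)]
      show ?thesis unfolding 4(1) V_cell(3)[OF l(1)]
        using cell_top[OF l' ap(3)] F_cell[OF l' ap(3)] G_cell[OF l' ap(3)]
        by (simp add: r_def r'_def cycle_path_arc0 cycle_path_middle[simplified] l(2,3))
    qed
  qed
  obtain b where b_join: "\<And>i j k p q. \<lbrakk>i \<in> I; j \<in> I; k \<in> I; pathin ?X p; pathin ?X q; p 0 = V i; p 1 = V j; q 0 = V j; q 1 = V k\<rbrakk>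
      \<Longrightarrow> b i (loop_join p q) k
            = b i p j + b j q k + sheet_change F (r i) p (r j) * sheet_change G (r' j) q (r' k)"
    and b_homotopic: "\<And>i j p q. \<lbrakk>i \<in> I; j \<in> I; path_homotopic ?X p q; p 0 = V i; p 1 = V j\<rbrakk>
      \<Longrightarrow> b i p j = b i q j"
    using free_fundamental_group_cochain[OF free F(1) G(1), of I V r r'] vertex path_connected_Conf[OF c]
    by blast
  have square: "b i p j + b j q k + sheet_change F (r i) p (r j) * sheet_change G (r' j) q (r' k)
      = b i p' j' + b j' q' k + sheet_change F (r i) p' (r j') * sheet_change G (r' j') q' (r' k)"
    if "i \<in> I" "j \<in> I" "k \<in> I" "j' \<in> I" and "path_homotopic ?X (loop_join p q) (loop_join p' q')"
      and "pathin ?X p" "pathin ?X q" "pathin ?X p'" "pathin ?X q'"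
      and "p 0 = V i" "p 1 = V j" "q 0 = V j" "q 1 = V k"
      and "p' 0 = V i" "p' 1 = V j'" "q' 0 = V j'" "q' 1 = V k"
    for i j k j' p q p' q'
    using b_join[of i j k p q] b_join[of i j' k p' q'] b_homotopic[of i k "loop_join p q" "loop_join p' q'"]
      that by simp
  have in_I: "(0, 0) \<in> I" "(3, 0) \<in> I" "(1, j) \<in> I" "(1, k) \<in> I" "(1, q) \<in> I" "(2, j) \<in> I" "(2, k) \<in> I" "(2, q) \<in> I"
    if "labelling j k q" for j k q
    using that by (auto simp: labelling_def I_def)
  define \<psi> where "\<psi> k j = sheet_change G (r' (1, k)) (U\<^sub>1 k j) (r' (2, 6 - j - k))" for k j
  have sum6: "6 - j - k = q" "6 - q - k = j" if "labelling j k q" for j k q :: nat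
    using that by (auto simp: labelling_def)
  have "\<psi> 1 2 + \<psi> 2 1 + \<psi> 1 3 + \<psi> 3 1 + \<psi> 2 3 + \<psi> 3 2 = 0"
  proof (rule parity_sum[where u\<^sub>0 = "\<lambda>j. b (0, 0) (U\<^sub>0 j) (1, j)" and d\<^sub>0 = "\<lambda>k. b (0, 0) (D\<^sub>0 k) (1, k)"
        and u\<^sub>1 = "\<lambda>k j. b (1, k) (U\<^sub>1 k j) (2, 6 - j - k)" and d\<^sub>1 = "\<lambda>j k. b (1, j) (D\<^sub>1 j k) (2, 6 - j - k)"
        and u\<^sub>2 = "\<lambda>j. b (2, j) (U\<^sub>2 j) (3, 0)" and d\<^sub>2 = "\<lambda>k. b (2, k) (D\<^sub>2 k) (3, 0)"
        and s = "\<lambda>j. sheet_change G (r' (2, j)) (U\<^sub>2 j) (r' (3, 0))"])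
    fix j k q assume l: "labelling j k q"
    note moves = moves_cell_path[OF l] and ends = moves_ends[OF l]
    have "sheet_change F (r (0, 0)) (U\<^sub>0 j) (r (1, j)) = 0"
      by (rule sheet_change_phase[OF F moves(1)]) (simp_all add: r_def)
    moreover have "sheet_change F (r (0, 0)) (D\<^sub>0 k) (r (1, k)) = 1"
      by (rule sheet_change_phase[OF F moves(2)]) (simp_all add: r_def)
    ultimately show "b (0, 0) (U\<^sub>0 j) (1, j) + b (1, j) (D\<^sub>1 j k) (2, 6 - j - k)
        = b (0, 0) (D\<^sub>0 k) (1, k) + b (1, k) (U\<^sub>1 k j) (2, 6 - j - k) + \<psi> k j"
      using square[OF in_I(1,3,8,4)[OF l] square_from_bottom[OF l] moves(1,4,2,3)[THEN pathin_cell_path]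
          ends(1,2,7,8,3,4,5,6)]
      by (simp only: \<psi>_def sum6(1)[OF l] mult_zero_left mult_1 add_0_right)
  next
    fix j k q assume l: "labelling j k q"
    note perm = labelling_perm[OF l]
    note U\<^sub>1 = moves_cell_path(3)[OF perm(1)] moves_ends(5,6)[OF perm(1)]
    note D\<^sub>1 = moves_cell_path(4)[OF perm(5)] moves_ends(7,8)[OF perm(5)]
    note moves = moves_cell_path(5,6)[OF l] and ends = moves_ends(9-12)[OF l]
    have "sheet_change F (r (1, q)) (U\<^sub>1 q j) (r (2, k)) = 0"
      by (rule sheet_change_phase[OF F U\<^sub>1(1)]) (simp_all add: r_def)
    moreover have "sheet_change F (r (1, q)) (D\<^sub>1 q k) (r (2, j)) = 1"
      by (rule sheet_change_phase[OF F D\<^sub>1(1)]) (simp_all add: r_def)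
    ultimately show "b (1, q) (U\<^sub>1 q j) (2, 6 - j - q) + b (2, k) (D\<^sub>2 k) (3, 0)
        = b (1, q) (D\<^sub>1 q k) (2, 6 - q - k) + b (2, j) (U\<^sub>2 j) (3, 0)
          + sheet_change G (r' (2, j)) (U\<^sub>2 j) (r' (3, 0))"
      using square[OF in_I(5,7,2,6)[OF l] square_to_top[OF l]
          pathin_cell_path[OF U\<^sub>1(1)] pathin_cell_path[OF moves(2)] pathin_cell_path[OF D\<^sub>1(1)] pathin_cell_path[OF moves(1)]
          U\<^sub>1(2,3) ends(3,4) D\<^sub>1(2,3) ends(1,2)]
      by (simp only: sum6(1)[OF perm(1)] sum6(1)[OF perm(5)] mult_zero_left mult_1 add_0_right)
  qed
  moreover have "\<psi> k j = (if j < k then 0 else 1)" if l: "labelling j k q" for j k q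
    unfolding \<psi>_def sum6(1)[OF l]
  proof (rule sheet_change_discriminant[OF G moves_cell_path(3)[OF l]])
    have swap: "vandermonde x y z = - vandermonde z y x" for x y z
      unfolding vandermonde_def by algebra
    have "r' (2, q) = (if j < k then vandermonde (M j) (A (1/2)) (M k) else - vandermonde (M j) (A (1/2)) (M k))"
    proof (cases "j < k")
      case True
      then show ?thesis using labelling_others[OF l True] by (simp add: r'_def)
    next
      case False
      then have "k < j" using l by (auto simp: labelling_def)
      then show ?thesis using labelling_others[OF labelling_perm(2)[OF l]] False swap[of "M k"] by (simp add: r'_def)
    qed
    then show "vandermonde (cycle_path j (1/4 - 3/4 * 1)) (cycle_path q (3/4 - 1/4)) (cycle_path k (- 1 / 2))
        = (if (if j < k then 0 else 1 :: bit) = 0 then r' (2, q) else - r' (2, q))"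
      by (simp add: cycle_path_arc0 cycle_path_middle[simplified])
    have "r' (1, k) = vandermonde (A (1/4)) (A (3/4)) (M k)" by (simp add: r'_def)
    then show "vandermonde (cycle_path j (1/4 - 3/4 * 0)) (cycle_path q (3/4 - 0/4)) (cycle_path k (-1/2))
        = r' (1, k)"
      unfolding cycle_path_middle(1) by (simp add: cycle_path_arc0)
  qed
  note this[of 2 1 3] this[of 1 2 3] this[of 3 1 2] this[of 1 3 2] this[of 3 2 1] this[of 2 3 1]
  ultimately show False by (simp add: labelling_def)
qed

end

theorem mainTheorem5:
  fixes m n1 n2 :: nat
    and c :: "(nat \<Rightarrow> (pulsar_vertex, pulsar_edge) graph_point) set"
  assumes "m \<ge> 4"
    and "c \<in> topspace (Conf 3 (graph_space (pulsar m n1 n2)))"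
  shows "\<not> is_free_group (graph_braid_group 3 (pulsar m n1 n2) c)"
proof -
  interpret pulsar_graph4 m n1 n2 by unfold_locales (use assms(1) in auto)
  show ?thesis unfolding graph_braid_group_def using assms(2) by (rule fundamental_group_Conf_not_free)
qed

end
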